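(* Let $K$ be a commutative ring with unit, $\lambda\in K$, $X$ a set, $\Omega=\{P\}$ with $P$ a unary operator symbol, and $$S=\{P(u)P(v)-P(P(u)v)-P(uP(v))-\lambda P(uv)\mid u,v\in\mathcal{Q}(X)\}\subseteq K[X;\Omega].$$ Then $K[X;\Omega|S]=K[X;\Omega]/Id(S)$ is a free commutative Rota-Baxter algebra of weight $\lambda$ on the set $X$, with a $K$-basis $\Phi(X)$ (that is, the images of the elements of $\Phi(X)$ form a $K$-basis).
   Context: Algebras are associative and not necessarily unital. A commutative Rota-Baxter algebra of weight $\lambda$ is a commutative $K$-algebra $R$ with a $K$-linear operator $P:R\to R$ satisfying $P(u)P(v)=P(P(u)v)+P(uP(v))+\lambda P(uv)$ for all $u,v\in R$. Morphisms are $K$-algebra homomorphisms commuting with $P$, and "free on $X$" is meant with respect to the canonical map from $X$. For a set $Y$, $CS(Y)$ is the free commutative semigroup on $Y$ (nonempty commutative words). Put $\mathcal{Q}_0=CS(X)$, $\mathcal{Q}_n=CS(X\cup\{P(u)\mid u\in\mathcal{Q}_{n-1}\})$ for $n\ge1$ (with $P(u)$ formal expressions), and $\mathcal{Q}(X)=\bigcup_{n\ge0}\mathcal{Q}_n$. $K[X;\Omega]$ is the commutative $K$-algebra with $K$-basis $\mathcal{Q}(X)$, with $P$ extended $K$-linearly. $Id(S)$ is the smallest ideal of $K[X;\Omega]$ containing $S$ and closed under $P$; the quotient carries the induced operator $P$. Define $\Phi_0=CS(X)$ and, for $n\ge1$, $\Phi_n=\Phi_0\cup P(\Phi_{n-1})\cup\Phi_0P(\Phi_{n-1})$,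 where $P(\Phi_{n-1})=\{P(v)\mid v\in\Phi_{n-1}\}$ and $\Phi_0P(\Phi_{n-1})=\{uP(v)\mid u\in\Phi_0,\ v\in\Phi_{n-1}\}$. Put $\Phi(X)=\bigcup_{n\ge0}\Phi_n\subseteq\mathcal{Q}(X)$. *)

theory Defs
  imports "HOL-Algebra.Module" "HOL-Algebra.QuotRing" "HOL-Library.Multiset" "HOL-Library.Poly_Mapping"
begin

section \<open>Operated and Rota-Baxter algebras\<close>

text \<open>
  Algebras need not be unital. They reuse the library's \<^type>\<open>module\<close> record, whose
  field \<^const>\<open>one\<close> is inherited from \<^type>\<open>ring\<close> and carries no meaning here: nothing
  below depends on it.
\<close>

record ('k, 'a) operated_algebra = "('k, 'a) module" +
  oper :: "'a \<Rightarrow> 'a"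

locale nonunital_comm_algebra = module K A for K (structure) and A (structure) +
  assumes alg_m_closed: "\<lbrakk>x \<in> carrier A; y \<in> carrier A\<rbrakk> \<Longrightarrow> x \<otimes>\<^bsub>A\<^esub> y \<in> carrier A"
    and alg_m_assoc: "\<lbrakk>x \<in> carrier A; y \<in> carrier A; z \<in> carrier A\<rbrakk>
      \<Longrightarrow> (x \<otimes>\<^bsub>A\<^esub> y) \<otimes>\<^bsub>A\<^esub> z = x \<otimes>\<^bsub>A\<^esub> (y \<otimes>\<^bsub>A\<^esub> z)"
    and alg_m_comm: "\<lbrakk>x \<in> carrier A; y \<in> carrier A\<rbrakk> \<Longrightarrow> x \<otimes>\<^bsub>A\<^esub> y = y \<otimes>\<^bsub>A\<^esub> x"
    and alg_l_distr: "\<lbrakk>x \<in> carrier A; y \<in> carrier A; z \<in> carrier A\<rbrakk>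
      \<Longrightarrow> (x \<oplus>\<^bsub>A\<^esub> y) \<otimes>\<^bsub>A\<^esub> z = (x \<otimes>\<^bsub>A\<^esub> z) \<oplus>\<^bsub>A\<^esub> (y \<otimes>\<^bsub>A\<^esub> z)"
    and alg_smult_assoc: "\<lbrakk>c \<in> carrier K; x \<in> carrier A; y \<in> carrier A\<rbrakk>
      \<Longrightarrow> (c \<odot>\<^bsub>A\<^esub> x) \<otimes>\<^bsub>A\<^esub> y = c \<odot>\<^bsub>A\<^esub> (x \<otimes>\<^bsub>A\<^esub> y)"

locale comm_rota_baxter_algebra =
  nonunital_comm_algebra K R
  for K (structure) and R :: "('k, 'a, 'm) operated_algebra_scheme" (structure) +
  fixes lam :: 'k
  assumes weight_closed: "lam \<in> carrier K"
    and oper_closed: "x \<in> carrier R \<Longrightarrow> oper R x \<in> carrier R"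
    and oper_add: "\<lbrakk>x \<in> carrier R; y \<in> carrier R\<rbrakk>
      \<Longrightarrow> oper R (x \<oplus>\<^bsub>R\<^esub> y) = oper R x \<oplus>\<^bsub>R\<^esub> oper R y"
    and oper_smult: "\<lbrakk>c \<in> carrier K; x \<in> carrier R\<rbrakk>
      \<Longrightarrow> oper R (c \<odot>\<^bsub>R\<^esub> x) = c \<odot>\<^bsub>R\<^esub> oper R x"
    and rota_baxter: "\<lbrakk>u \<in> carrier R; v \<in> carrier R\<rbrakk>
      \<Longrightarrow> oper R u \<otimes>\<^bsub>R\<^esub> oper R v =
          oper R (oper R u \<otimes>\<^bsub>R\<^esub> v) \<oplus>\<^bsub>R\<^esub> oper R (u \<otimes>\<^bsub>R\<^esub> oper R v)
            \<oplus>\<^bsub>R\<^esub> lam \<odot>\<^bsub>R\<^esub> oper R (u \<otimes>\<^bsub>R\<^esub> v)"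

definition rb_hom ::
  "('k, 'n) ring_scheme \<Rightarrow> ('k, 'a, 'm) operated_algebra_scheme
    \<Rightarrow> ('k, 'b, 'l) operated_algebra_scheme \<Rightarrow> ('a \<Rightarrow> 'b) set"
  where "rb_hom K R S = {h \<in> carrier R \<rightarrow> carrier S.
    (\<forall>x\<in>carrier R. \<forall>y\<in>carrier R. h (x \<oplus>\<^bsub>R\<^esub> y) = h x \<oplus>\<^bsub>S\<^esub> h y) \<and>
    (\<forall>x\<in>carrier R. \<forall>y\<in>carrier R. h (x \<otimes>\<^bsub>R\<^esub> y) = h x \<otimes>\<^bsub>S\<^esub> h y) \<and>
    (\<forall>c\<in>carrier K. \<forall>x\<in>carrier R. h (c \<odot>\<^bsub>R\<^esub> x) = c \<odot>\<^bsub>S\<^esub> h x) \<and>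
    (\<forall>x\<in>carrier R. h (oper R x) = oper S (h x))}"

text \<open>
  The universal property of \<open>F\<close> with respect to \<open>\<iota>\<close>. A formula cannot quantify over
  types, so the carrier type \<open>'r\<close> of the test algebras is a type parameter; in a theorem it is
  an arbitrary type variable. Homomorphisms are made \<^const>\<open>extensional\<close> so that
  uniqueness means equality on the carrier of \<open>F\<close>.
\<close>

definition free_comm_rota_baxter_algebra ::
  "'r itself \<Rightarrow> ('k, 'n) ring_scheme \<Rightarrow> 'k \<Rightarrow> 'x set
    \<Rightarrow> ('k, 'a, 'm) operated_algebra_scheme \<Rightarrow> ('x \<Rightarrow> 'a) \<Rightarrow> bool"
  where "free_comm_rota_baxter_algebra _ K lam X F \<iota> \<longleftrightarrow>
    comm_rota_baxter_algebra K F lam \<and> \<iota> \<in> X \<rightarrow> carrier F \<and>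
    (\<forall>(R :: ('k, 'r) operated_algebra) f.
      comm_rota_baxter_algebra K R lam \<and> f \<in> X \<rightarrow> carrier R \<longrightarrow>
      (\<exists>!h. h \<in> rb_hom K F R \<inter> extensional (carrier F) \<and> (\<forall>x\<in>X. h (\<iota> x) = f x)))"

text \<open>
  A basis is an indexed family. Over the trivial ring \<open>K\<close> it need not be injective;
  otherwise independence forces it to be.
\<close>

definition is_module_basis ::
  "('k, 'n) ring_scheme \<Rightarrow> ('k, 'a, 'm) module_scheme \<Rightarrow> 'i set \<Rightarrow> ('i \<Rightarrow> 'a) \<Rightarrow> bool"
  where "is_module_basis K M I b \<longleftrightarrow>
    b \<in> I \<rightarrow> carrier M \<and>
    (\<forall>a\<in>carrier M. \<exists>J c. finite J \<and> J \<subseteq> I \<and> c \<in> J \<rightarrow> carrier K \<and>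
      a = (\<Oplus>\<^bsub>M\<^esub>i\<in>J. c i \<odot>\<^bsub>M\<^esub> b i)) \<and>
    (\<forall>J c. finite J \<and> J \<subseteq> I \<and> c \<in> J \<rightarrow> carrier K \<and>
      (\<Oplus>\<^bsub>M\<^esub>i\<in>J. c i \<odot>\<^bsub>M\<^esub> b i) = \<zero>\<^bsub>M\<^esub> \<longrightarrow> (\<forall>i\<in>J. c i = \<zero>\<^bsub>K\<^esub>))"


section \<open>Operated ideals and quotients\<close>

definition operated_ideal ::
  "('k, 'n) ring_scheme \<Rightarrow> ('k, 'a, 'm) operated_algebra_scheme \<Rightarrow> 'a set \<Rightarrow> bool"
  where "operated_ideal K A I \<longleftrightarrow>
    submodule I K A \<and>
    (\<forall>a\<in>carrier A. \<forall>x\<in>I. a \<otimes>\<^bsub>A\<^esub> x \<in> I \<and> x \<otimes>\<^bsub>A\<^esub> a \<in> I) \<and>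
    (\<forall>x\<in>I. oper A x \<in> I)"

definition gen_operated_ideal ::
  "('k, 'n) ring_scheme \<Rightarrow> ('k, 'a, 'm) operated_algebra_scheme \<Rightarrow> 'a set \<Rightarrow> 'a set"
  where "gen_operated_ideal K A S = \<Inter>{I. operated_ideal K A I \<and> S \<subseteq> I}"

text \<open>
  As for \<^const>\<open>rcoset_mult\<close>, an operation on cosets is the union of the cosets of all
  results on representatives, which is a single coset when \<open>I\<close> is an operated ideal.
\<close>

definition quotient_algebra ::
  "('k, 'a, 'm) operated_algebra_scheme \<Rightarrow> 'a set \<Rightarrow> ('k, 'a set) operated_algebra"
  where "quotient_algebra A I =
    \<lparr>carrier = a_rcosets\<^bsub>A\<^esub> I, monoid.mult = rcoset_mult A I, one = undefined,
     zero = I, add = set_add A,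
     smult = (\<lambda>c U. \<Union>u\<in>U. I +>\<^bsub>A\<^esub> (c \<odot>\<^bsub>A\<^esub> u)),
     oper = (\<lambda>U. \<Union>u\<in>U. I +>\<^bsub>A\<^esub> oper A u)\<rparr>"


section \<open>Words\<close>

text \<open>
  A commutative word is the multiset of its letters; multiplication is multiset sum. The word
  \<open>P(u)\<close> is the one-letter word with letter \<open>Op u\<close>.
\<close>

datatype 'x letter = Var 'x | Op "'x letter multiset"

type_synonym 'x word = "'x letter multiset"

definition var_word :: "'x \<Rightarrow> 'x word"
  where "var_word x = {#Var x#}"

definition op_word :: "'x word \<Rightarrow> 'x word"
  where "op_word u = {#Op u#}"

definition free_comm_semigroup :: "'y set \<Rightarrow> 'y multiset set"
  where "free_comm_semigroup Y = {w. w \<noteq> {#} \<and> set_mset w \<subseteq> Y}"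

primrec Q_stage :: "'x set \<Rightarrow> nat \<Rightarrow> 'x word set"
  where
    "Q_stage X 0 = free_comm_semigroup (Var ` X)"
  | "Q_stage X (Suc n) = free_comm_semigroup (Var ` X \<union> Op ` Q_stage X n)"

definition Q_words :: "'x set \<Rightarrow> 'x word set"
  where "Q_words X = (\<Union>n. Q_stage X n)"

primrec Phi_stage :: "'x set \<Rightarrow> nat \<Rightarrow> 'x word set"
  where
    "Phi_stage X 0 = free_comm_semigroup (Var ` X)"
  | "Phi_stage X (Suc n) =
      free_comm_semigroup (Var ` X) \<union> op_word ` Phi_stage X n
        \<union> {u + op_word v | u v. u \<in> free_comm_semigroup (Var ` X) \<and> v \<in> Phi_stage X n}"

definition Phi_words :: "'x set \<Rightarrow> 'x word set"
  where "Phi_words X = (\<Union>n. Phi_stage X n)"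


section \<open>The free operated algebra and its Rota-Baxter quotient\<close>

text \<open>
  The coefficient ring is a type of sort \<open>{comm_ring, comm_monoid_mult}\<close>: a commutative ring
  with unit in which, unlike in \<^class>\<open>comm_ring_1\<close>, \<open>0 = 1\<close> is allowed.
\<close>

definition scalar_ring :: "'k::{comm_ring, comm_monoid_mult} ring"
  where "scalar_ring =
    \<lparr>carrier = UNIV, monoid.mult = (*), one = 1, zero = 0, add = (+)\<rparr>"

definition word_poly :: "'x word \<Rightarrow> ('x word \<Rightarrow>\<^sub>0 'k::{comm_ring, comm_monoid_mult})"
  where "word_poly w = Poly_Mapping.single w 1"

definition poly_scale ::
  "'k::{comm_ring, comm_monoid_mult} \<Rightarrow> ('x word \<Rightarrow>\<^sub>0 'k) \<Rightarrow> ('x word \<Rightarrow>\<^sub>0 'k)"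
  where "poly_scale c f = Poly_Mapping.map ((*) c) f"

definition poly_oper ::
  "('x word \<Rightarrow>\<^sub>0 'k::{comm_ring, comm_monoid_mult}) \<Rightarrow> ('x word \<Rightarrow>\<^sub>0 'k)"
  where "poly_oper f =
    (\<Sum>w\<in>Poly_Mapping.keys f. Poly_Mapping.single (op_word w) (Poly_Mapping.lookup f w))"

text \<open>
  The multiplication of \<^type>\<open>poly_mapping\<close> is the bilinear extension of \<open>+\<close> on
  multisets, that is, of the multiplication of words.
\<close>

definition free_operated_algebra ::
  "'x set \<Rightarrow> ('k::{comm_ring, comm_monoid_mult}, 'x word \<Rightarrow>\<^sub>0 'k) operated_algebra"
  where "free_operated_algebra X =
    \<lparr>carrier = {f. Poly_Mapping.keys f \<subseteq> Q_words X}, monoid.mult = (*), one = undefined,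
     zero = 0, add = (+), smult = poly_scale, oper = poly_oper\<rparr>"

definition rb_relations ::
  "'k::{comm_ring, comm_monoid_mult} \<Rightarrow> 'x set \<Rightarrow> ('x word \<Rightarrow>\<^sub>0 'k) set"
  where "rb_relations lam X =
    {word_poly (op_word u + op_word v) - word_poly (op_word (op_word u + v))
       - word_poly (op_word (u + op_word v)) - poly_scale lam (word_poly (op_word (u + v)))
     | u v. u \<in> Q_words X \<and> v \<in> Q_words X}"

definition rb_ideal ::
  "'k::{comm_ring, comm_monoid_mult} \<Rightarrow> 'x set \<Rightarrow> ('x word \<Rightarrow>\<^sub>0 'k) set"
  where "rb_ideal lam X =
    gen_operated_ideal scalar_ring (free_operated_algebra X) (rb_relations lam X)"

definition rb_quotient ::
  "'k::{comm_ring, comm_monoid_mult} \<Rightarrow> 'x set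
    \<Rightarrow> ('k, ('x word \<Rightarrow>\<^sub>0 'k) set) operated_algebra"
  where "rb_quotient lam X = quotient_algebra (free_operated_algebra X) (rb_ideal lam X)"

definition rb_class ::
  "'k::{comm_ring, comm_monoid_mult} \<Rightarrow> 'x set \<Rightarrow> 'x word \<Rightarrow> ('x word \<Rightarrow>\<^sub>0 'k) set"
  where "rb_class lam X w = rb_ideal lam X +>\<^bsub>free_operated_algebra X\<^esub> word_poly w"

end

theory Submission
  imports Defs
begin

text \<open>
  Evaluation of words makes the quotient free. The normal forms span it because a product of two
  of them, \<open>u P(v) \<cdot> u' P(v')\<close>, is rewritten by the Rota-Baxter relation as
  \<open>u u' (P(P(v) v') + P(v P(v')) + \<lambda> P(v v'))\<close>, whose inner products involve fewer nestings
  of \<open>P\<close>. They are independent because a concrete commutative Rota-Baxter algebra separates them: the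
  tensor product of the monoid algebra of commutative words with the quasi-shuffle algebra on lists
  of such words. There \<open>u\<^sub>0 P(u\<^sub>1 P(\<dots> P(u\<^sub>k)))\<close> evaluates to the single basis element
  \<open>(u\<^sub>0, [u\<^sub>1, \<dots>, u\<^sub>k])\<close>.
\<close>

subsection \<open>Linear and bilinear extension\<close>

text \<open>Rewriting by itself yields spanning only: nothing in it excludes that two reductions of
  one word end in different combinations of normal forms, which would be a linear relation among
  them. No confluence check is made; a single model in which every word has a definite value takes
  its place. The product in the model is forced. If a pair \<open>(u0, [u1, ..., uk])\<close> is to
  stand for the nested word, then P must move the first component into the list, and the Rota-Baxter
  identity then prescribes the product of two lists recursively, its three terms becoming the three
  summands of the quasi-shuffle. The price is associativity of that product, the one substantial
  computation. List entries may be empty, because P can be applied directly to P(v); hence the model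
  is built over the monoid of all multisets, although Q(X) has no empty word. To separate the normal
  forms it suffices that a word can be decoded from the basis element it evaluates to. All of this
  is linear extension from words, so the coefficient ring stays arbitrary.\<close>

definition pscale :: "'k::{comm_ring, comm_monoid_mult} \<Rightarrow> ('a \<Rightarrow>\<^sub>0 'k) \<Rightarrow> ('a \<Rightarrow>\<^sub>0 'k)"
  where "pscale c p = Poly_Mapping.map ((*) c) p"

lemma lookup_pscale [simp]: "Poly_Mapping.lookup (pscale c p) w = c * Poly_Mapping.lookup p w"
  unfolding pscale_def by (simp add: map.rep_eq when_def)

lemma pscale_zero [simp]: "pscale c 0 = 0" "pscale 0 p = 0"
  by (rule poly_mapping_eqI, simp)+

lemma pscale_one [simp]: "pscale 1 p = p"
  by (rule poly_mapping_eqI) simp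

lemma pscale_add: "pscale c (p + q) = pscale c p + pscale c q"
  by (rule poly_mapping_eqI) (simp add: lookup_add distrib_left)

lemma pscale_add_left: "pscale (c + d) p = pscale c p + pscale d p"
  by (rule poly_mapping_eqI) (simp add: lookup_add distrib_right)

lemma pscale_pscale [simp]: "pscale c (pscale d p) = pscale (c * d) p"
  by (rule poly_mapping_eqI) (simp add: mult.assoc)

lemma pscale_single [simp]: "pscale c (Poly_Mapping.single w d) = Poly_Mapping.single w (c * d)"
  by (rule poly_mapping_eqI) (simp add: lookup_single when_def)

lemma keys_pscale: "Poly_Mapping.keys (pscale c p) \<subseteq> Poly_Mapping.keys p"
  by (auto simp: in_keys_iff)

text \<open>The support stays inside \<open>W\<close> throughout the induction. This matters because
  membership in the free operated algebra, or in the span of normal forms, is a condition on the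
  support.\<close>

lemma keys_subset_induct [consumes 1, case_names zero single_add]:
  assumes "Poly_Mapping.keys p \<subseteq> W"
    and "P 0"
    and "\<And>w c p. w \<in> W \<Longrightarrow> Poly_Mapping.keys p \<subseteq> W \<Longrightarrow> P p \<Longrightarrow> P (Poly_Mapping.single w c + p)"
  shows "P p"
  using assms(1)
proof (induction p rule: update_induct)
  case const
  show ?case by (fact assms(2))
next
  case (update p a b)
  \<comment> \<open>\<open>a\<close> is a fresh key, so overwriting its coefficient and adding a
    monomial agree.\<close>
  have eq: "Poly_Mapping.update a b p = Poly_Mapping.single a b + p"
    using update.hyps
    by (intro poly_mapping_eqI) (auto simp: lookup_update lookup_add lookup_single in_keys_iff when_def)
  have "Poly_Mapping.keys (Poly_Mapping.update a b p) = insert a (Poly_Mapping.keys p)"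
    using update.hyps by (auto simp: keys_update)
  then show ?case
    using update assms(3)[of a p b] eq by simp
qed

definition plin :: "('a \<Rightarrow> ('b \<Rightarrow>\<^sub>0 'k)) \<Rightarrow> ('a \<Rightarrow>\<^sub>0 'k::{comm_ring, comm_monoid_mult}) \<Rightarrow> ('b \<Rightarrow>\<^sub>0 'k)"
  where "plin \<phi> p = (\<Sum>w\<in>Poly_Mapping.keys p. pscale (Poly_Mapping.lookup p w) (\<phi> w))"

lemma plin_zero [simp]: "plin \<phi> 0 = 0"
  by (simp add: plin_def)

lemma plin_add [simp]: "plin \<phi> (p + q) = plin \<phi> p + plin \<phi> q"
  unfolding plin_def by (rule setsum_keys_plus_distrib) (simp_all add: pscale_add_left)

lemma plin_single [simp]: "plin \<phi> (Poly_Mapping.single w c) = pscale c (\<phi> w)"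
  by (cases "c = 0") (simp_all add: plin_def)

lemma poly_mapping_linear_induct [case_names zero add]:
  assumes "P 0" and "\<And>w c p. P p \<Longrightarrow> P (Poly_Mapping.single w c + p)"
  shows "P p"
  by (rule keys_subset_induct[of p UNIV P]) (simp_all add: assms)

lemma plin_pscale [simp]: "plin \<phi> (pscale c p) = pscale c (plin \<phi> p)"
  by (induction p rule: poly_mapping_linear_induct) (simp_all add: pscale_add)

lemma plin_fun_add: "plin (\<lambda>w. \<phi> w + \<psi> w) p = plin \<phi> p + plin \<psi> p"
  by (induction p rule: poly_mapping_linear_induct) (simp_all add: pscale_add algebra_simps)

lemma plin_fun_pscale: "plin (\<lambda>w. pscale c (\<phi> w)) p = pscale c (plin \<phi> p)"
  by (induction p rule: poly_mapping_linear_induct) (simp_all add: pscale_add mult.commute)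

lemma plin_fun_zero [simp]: "plin (\<lambda>w. 0) p = 0"
  by (simp add: plin_def)

lemma plin_plin: "plin \<phi> (plin \<psi> p) = plin (\<lambda>w. plin \<phi> (\<psi> w)) p"
  by (induction p rule: poly_mapping_linear_induct) simp_all

lemma plin_id [simp]: "plin (\<lambda>w. Poly_Mapping.single w 1) p = p"
  by (induction p rule: poly_mapping_linear_induct) simp_all

text \<open>The built-in product of \<open>poly_mapping\<close> sends two basis elements to one
  basis element. A shuffle of two lists is a sum, so the bilinear extension has to accept a
  polynomial-valued \<open>\<phi>\<close>.\<close>

definition pmul :: "('a \<Rightarrow> 'b \<Rightarrow> ('c \<Rightarrow>\<^sub>0 'k)) \<Rightarrow> ('a \<Rightarrow>\<^sub>0 'k::{comm_ring, comm_monoid_mult})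
    \<Rightarrow> ('b \<Rightarrow>\<^sub>0 'k) \<Rightarrow> ('c \<Rightarrow>\<^sub>0 'k)"
  where "pmul \<phi> p q = plin (\<lambda>u. plin (\<phi> u) q) p"

lemma pmul_zero [simp]: "pmul \<phi> 0 q = 0" "pmul \<phi> p 0 = 0"
  by (simp_all add: pmul_def)

lemma pmul_add_left: "pmul \<phi> (p + p') q = pmul \<phi> p q + pmul \<phi> p' q"
  and pmul_add_right: "pmul \<phi> p (q + q') = pmul \<phi> p q + pmul \<phi> p q'"
  by (simp_all add: pmul_def plin_fun_add)

lemma pmul_pscale_left: "pmul \<phi> (pscale c p) q = pscale c (pmul \<phi> p q)"
  and pmul_pscale_right: "pmul \<phi> p (pscale c q) = pscale c (pmul \<phi> p q)"
  by (simp_all add: pmul_def plin_fun_pscale)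

lemmas pmul_linear = pmul_add_left pmul_add_right pmul_pscale_left pmul_pscale_right

lemma pmul_single: "pmul \<phi> (Poly_Mapping.single u c) (Poly_Mapping.single v d) = pscale (c * d) (\<phi> u v)"
  by (simp add: pmul_def)

lemma single_conv_pscale: "Poly_Mapping.single u c = pscale c (Poly_Mapping.single u 1)"
  by simp

text \<open>Linearity is a hypothesis on bare functions, so a multilinear identity can be reduced to
  basis elements one argument at a time.\<close>

lemma linear_eqI:
  fixes F G :: "('a \<Rightarrow>\<^sub>0 'k::{comm_ring, comm_monoid_mult}) \<Rightarrow> ('b \<Rightarrow>\<^sub>0 'k)"
  assumes "\<And>p q. F (p + q) = F p + F q" "\<And>c p. F (pscale c p) = pscale c (F p)"
    and "\<And>p q. G (p + q) = G p + G q" "\<And>c p. G (pscale c p) = pscale c (G p)"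
    and "\<And>w. F (Poly_Mapping.single w 1) = G (Poly_Mapping.single w 1)"
  shows "F p = G p"
proof (induction p rule: poly_mapping_linear_induct)
  case zero
  show ?case using assms(2)[of 0 0] assms(4)[of 0 0] by simp
next
  case (add w c p)
  then show ?case
    using assms(2)[of c "Poly_Mapping.single w 1"] assms(4)[of c "Poly_Mapping.single w 1"]
    by (simp add: assms(1,3,5))
qed

lemma pmul_commute:
  assumes "\<And>u v. \<phi> u v = \<phi> v u"
  shows "pmul \<phi> p q = pmul \<phi> q p"
proof (rule linear_eqI[where p = p])
  fix u
  show "pmul \<phi> (Poly_Mapping.single u 1) q = pmul \<phi> q (Poly_Mapping.single u 1)"
    by (rule linear_eqI[where p = q]) (simp_all add: pmul_linear pmul_single assms[of u])
qed (simp_all add: pmul_linear)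

lemma pmul_assoc:
  assumes "\<And>u v w. pmul \<phi> (\<phi> u v) (Poly_Mapping.single w 1) = pmul \<phi> (Poly_Mapping.single u 1) (\<phi> v w)"
  shows "pmul \<phi> (pmul \<phi> p q) r = pmul \<phi> p (pmul \<phi> q r)"
proof (rule linear_eqI[where p = p])
  fix u
  show "pmul \<phi> (pmul \<phi> (Poly_Mapping.single u 1) q) r = pmul \<phi> (Poly_Mapping.single u 1) (pmul \<phi> q r)"
  proof (rule linear_eqI[where p = q])
    fix v
    show "pmul \<phi> (pmul \<phi> (Poly_Mapping.single u 1) (Poly_Mapping.single v 1)) r
        = pmul \<phi> (Poly_Mapping.single u 1) (pmul \<phi> (Poly_Mapping.single v 1) r)"
      by (rule linear_eqI[where p = r]) (simp_all add: pmul_linear pmul_single assms)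
  qed (simp_all add: pmul_linear)
qed (simp_all add: pmul_linear)


subsection \<open>The quasi-shuffle product\<close>

text \<open>A list stands for a pure tensor of its entries; this is tensoring with \<open>a\<close>
  on the left.\<close>

definition pcons :: "'m \<Rightarrow> ('m list \<Rightarrow>\<^sub>0 'k::{comm_ring, comm_monoid_mult}) \<Rightarrow> ('m list \<Rightarrow>\<^sub>0 'k)"
  where "pcons a = plin (\<lambda>s. Poly_Mapping.single (a # s) 1)"

lemma pcons_linear [simp]:
  "pcons a (p + q) = pcons a p + pcons a q"
  "pcons a (pscale c p) = pscale c (pcons a p)"
  "pcons a (Poly_Mapping.single s c) = Poly_Mapping.single (a # s) c"
  by (simp_all add: pcons_def)

text \<open>The result starts with the head of the left list, with that of the right list, or with
  both heads merged. Reading a head as the content of an outermost P, these are the terms of the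
  Rota-Baxter identity, which is why only the merged one carries the weight.\<close>

fun quasi_shuffle :: "'k::{comm_ring, comm_monoid_mult} \<Rightarrow> 'm::comm_monoid_add list \<Rightarrow> 'm list
    \<Rightarrow> ('m list \<Rightarrow>\<^sub>0 'k)"
  where
    "quasi_shuffle lam [] t = Poly_Mapping.single t 1"
  | "quasi_shuffle lam s [] = Poly_Mapping.single s 1"
  | "quasi_shuffle lam (a # s) (b # t) = pcons a (quasi_shuffle lam s (b # t))
       + pcons b (quasi_shuffle lam (a # s) t) + pscale lam (pcons (a + b) (quasi_shuffle lam s t))"

lemma quasi_shuffle_Nil_right [simp]: "quasi_shuffle lam s [] = Poly_Mapping.single s 1"
  by (cases s) simp_all

lemma quasi_shuffle_commute: "quasi_shuffle lam s t = quasi_shuffle lam t s"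
  by (induction lam s t rule: quasi_shuffle.induct) (simp_all add: algebra_simps)

abbreviation qmul :: "'k::{comm_ring, comm_monoid_mult} \<Rightarrow> ('m::comm_monoid_add list \<Rightarrow>\<^sub>0 'k)
    \<Rightarrow> ('m list \<Rightarrow>\<^sub>0 'k) \<Rightarrow> ('m list \<Rightarrow>\<^sub>0 'k)"
  where "qmul lam \<equiv> pmul (quasi_shuffle lam)"

lemma qmul_commute: "qmul lam p q = qmul lam q p"
  by (rule pmul_commute) (rule quasi_shuffle_commute)

lemma qmul_Nil [simp]:
  "qmul lam p (Poly_Mapping.single [] 1) = p" "qmul lam (Poly_Mapping.single [] 1) p = p"
proof -
  show "qmul lam p (Poly_Mapping.single [] 1) = p" for p
    by (simp add: pmul_def)
  then show "qmul lam (Poly_Mapping.single [] 1) p = p"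
    by (simp add: qmul_commute)
qed

text \<open>The recursion lifted from lists to polynomials. The proofs of associativity and of the
  Rota-Baxter identity compute with this form.\<close>

lemma qmul_pcons:
  "qmul lam (pcons a p) (pcons b q) = pcons a (qmul lam p (pcons b q))
     + pcons b (qmul lam (pcons a p) q) + pscale lam (pcons (a + b) (qmul lam p q))"
proof (rule linear_eqI[where p = p])
  fix u
  show "qmul lam (pcons a (Poly_Mapping.single u 1)) (pcons b q)
     = pcons a (qmul lam (Poly_Mapping.single u 1) (pcons b q))
     + pcons b (qmul lam (pcons a (Poly_Mapping.single u 1)) q)
     + pscale lam (pcons (a + b) (qmul lam (Poly_Mapping.single u 1) q))"
    by (rule linear_eqI[where p = q])
      (simp_all add: pmul_linear pscale_add algebra_simps pmul_single)
qed (simp_all add: pmul_linear pscale_add algebra_simps)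

text \<open>Both bracketings split by the first entry of the result, which is the sum over a
  nonempty subset of the three heads. The seven parts agree pairwise by induction on the total
  length.\<close>

lemma quasi_shuffle_assoc:
  fixes lam :: "'k::{comm_ring, comm_monoid_mult}" and s t u :: "'m::comm_monoid_add list"
  shows "qmul lam (quasi_shuffle lam s t) (Poly_Mapping.single u 1)
     = qmul lam (Poly_Mapping.single s 1) (quasi_shuffle lam t u)"
proof (induction "length s + length t + length u" arbitrary: s t u rule: less_induct)
  case less
  show ?case
  proof (cases "s = [] \<or> t = [] \<or> u = []")
    case True
    then show ?thesis by (auto simp: pmul_single)
  next
    case False
    then obtain a s' b t' c u' where eqs: "s = a # s'" "t = b # t'" "u = c # u'"
      by (metis neq_Nil_conv)
    \<comment> \<open>Opaque names for the tails and the product keep the simplifier from collapsing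
      \<open>pcons\<close> of a monomial back into a monomial.\<close>
    define S T U where "S = Poly_Mapping.single s' (1::'k)" "T = Poly_Mapping.single t' (1::'k)"
      "U = Poly_Mapping.single u' (1::'k)"
    define m :: "('m list \<Rightarrow>\<^sub>0 'k) \<Rightarrow> ('m list \<Rightarrow>\<^sub>0 'k) \<Rightarrow> ('m list \<Rightarrow>\<^sub>0 'k)"
      where "m = qmul lam"
    have s: "Poly_Mapping.single s 1 = pcons a S" and t: "Poly_Mapping.single t 1 = pcons b T"
      and u: "Poly_Mapping.single u 1 = pcons c U"
      by (simp_all add: S_T_U_def eqs)
    have IH: "m (m (Poly_Mapping.single x 1) (Poly_Mapping.single y 1)) (Poly_Mapping.single z 1)
        = m (Poly_Mapping.single x 1) (m (Poly_Mapping.single y 1) (Poly_Mapping.single z 1))"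
      if "length x + length y + length z < length s + length t + length u" for x y z
      using less[OF that] by (simp add: m_def pmul_single)
    have IHs:
      "m (m S (pcons b T)) (pcons c U) = m S (m (pcons b T) (pcons c U))"
      "m (m S (pcons b T)) U = m S (m (pcons b T) U)"
      "m (m (pcons a S) T) (pcons c U) = m (pcons a S) (m T (pcons c U))"
      "m (m (pcons a S) T) U = m (pcons a S) (m T U)"
      "m (m S T) (pcons c U) = m S (m T (pcons c U))"
      "m (m (pcons a S) (pcons b T)) U = m (pcons a S) (m (pcons b T) U)"
      "m (m S T) U = m S (m T U)"
      unfolding s[symmetric] t[symmetric] u[symmetric] unfolding S_T_U_def
      by (rule IH; simp add: eqs)+
    have step: "m (pcons x p) (pcons y q) = pcons x (m p (pcons y q)) + pcons y (m (pcons x p) q)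
        + pscale lam (pcons (x + y) (m p q))" for x y p q
      unfolding m_def by (rule qmul_pcons)
    have lin: "m (p + p') q = m p q + m p' q" "m p (q + q') = m p q + m p q'"
      "m (pscale k p) q = pscale k (m p q)" "m p (pscale k q) = pscale k (m p q)" for p p' q q' k
      unfolding m_def by (rule pmul_linear)+
    \<comment> \<open>The terms that start with \<open>c\<close> come from all three summands of the
      inner product and recombine to one product with \<open>U\<close>. On the other side the same
      happens with \<open>a\<close>.\<close>
    have L: "m (m (pcons a S) (pcons b T)) (pcons c U)
      = pcons a (m (m S (pcons b T)) (pcons c U)) + pscale lam (pcons (a + c) (m (m S (pcons b T)) U))
      + pcons b (m (m (pcons a S) T) (pcons c U)) + pscale lam (pcons (b + c) (m (m (pcons a S) T) U))
      + pscale lam (pcons (a + b) (m (m S T) (pcons c U)))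
      + pscale (lam * lam) (pcons (a + b + c) (m (m S T) U))
      + pcons c (m (m (pcons a S) (pcons b T)) U)"
      by (simp add: step[of a S b T] lin step[of _ _ c U] pscale_add algebra_simps)
    have R: "m (pcons a S) (m (pcons b T) (pcons c U))
      = pcons a (m S (m (pcons b T) (pcons c U))) + pscale lam (pcons (a + c) (m S (m (pcons b T) U)))
      + pcons b (m (pcons a S) (m T (pcons c U))) + pscale lam (pcons (b + c) (m (pcons a S) (m T U)))
      + pscale lam (pcons (a + b) (m S (m T (pcons c U))))
      + pscale (lam * lam) (pcons (a + b + c) (m S (m T U)))
      + pcons c (m (pcons a S) (m (pcons b T) U))"
      by (simp add: step[of b T c U] lin step[of a S] pscale_add algebra_simps)
    have "m (m (pcons a S) (pcons b T)) (pcons c U) = m (pcons a S) (m (pcons b T) (pcons c U))"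
      unfolding L R by (simp only: IHs)
    then show ?thesis
      unfolding s[symmetric] t[symmetric] u[symmetric] by (simp add: m_def pmul_single)
  qed
qed


subsection \<open>The free commutative Rota-Baxter algebra on a monoid algebra\<close>

text \<open>A pair \<open>(a, s)\<close> is the pure tensor of a monoid element and a list.\<close>

definition ptag :: "'m \<Rightarrow> ('m list \<Rightarrow>\<^sub>0 'k::{comm_ring, comm_monoid_mult}) \<Rightarrow> ('m \<times> 'm list \<Rightarrow>\<^sub>0 'k)"
  where "ptag a = plin (\<lambda>s. Poly_Mapping.single (a, s) 1)"

lemma ptag_linear [simp]:
  "ptag a (p + q) = ptag a p + ptag a q"
  "ptag a (pscale c p) = pscale c (ptag a p)"
  "ptag a (Poly_Mapping.single s c) = Poly_Mapping.single (a, s) c"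
  by (simp_all add: ptag_def)

definition mixable_shuffle :: "'k::{comm_ring, comm_monoid_mult} \<Rightarrow> 'm::comm_monoid_add \<times> 'm list
    \<Rightarrow> 'm \<times> 'm list \<Rightarrow> ('m \<times> 'm list \<Rightarrow>\<^sub>0 'k)"
  where "mixable_shuffle lam u v = ptag (fst u + fst v) (quasi_shuffle lam (snd u) (snd v))"

text \<open>The monoid is written additively, so the \<open>0\<close> is its unit: P sends the
  tensor of \<open>a\<close> and \<open>s\<close> to the tensor of the unit and
  \<open>a # s\<close>.\<close>

definition mixable_oper :: "('m::comm_monoid_add \<times> 'm list \<Rightarrow>\<^sub>0 'k::{comm_ring, comm_monoid_mult})
    \<Rightarrow> ('m \<times> 'm list \<Rightarrow>\<^sub>0 'k)"
  where "mixable_oper = plin (\<lambda>u. Poly_Mapping.single (0, fst u # snd u) 1)"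

lemma mixable_oper_linear [simp]:
  "mixable_oper (p + q) = mixable_oper p + mixable_oper q"
  "mixable_oper (pscale c p) = pscale c (mixable_oper p)"
  "mixable_oper (Poly_Mapping.single u c) = Poly_Mapping.single (0, fst u # snd u) c"
  by (simp_all add: mixable_oper_def)

lemma mixable_oper_ptag [simp]: "mixable_oper (ptag a p) = ptag 0 (pcons a p)"
  by (simp add: mixable_oper_def ptag_def pcons_def plin_plin)

abbreviation mmul :: "'k::{comm_ring, comm_monoid_mult} \<Rightarrow> ('m::comm_monoid_add \<times> 'm list \<Rightarrow>\<^sub>0 'k)
    \<Rightarrow> ('m \<times> 'm list \<Rightarrow>\<^sub>0 'k) \<Rightarrow> ('m \<times> 'm list \<Rightarrow>\<^sub>0 'k)"
  where "mmul lam \<equiv> pmul (mixable_shuffle lam)"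

lemma mmul_ptag: "mmul lam (ptag a p) (ptag b q) = ptag (a + b) (qmul lam p q)"
proof (rule linear_eqI[where p = p])
  fix u
  show "mmul lam (ptag a (Poly_Mapping.single u 1)) (ptag b q)
      = ptag (a + b) (qmul lam (Poly_Mapping.single u 1) q)"
    by (rule linear_eqI[where p = q]) (simp_all add: pmul_linear pmul_single mixable_shuffle_def)
qed (simp_all add: pmul_linear)

text \<open>Exposes the two tensor factors to \<open>mmul_ptag\<close>. Proofs that rewrite with it
  switch off the inverse rule \<open>ptag_linear(3)\<close>.\<close>

lemma single_pair_conv_ptag: "Poly_Mapping.single u 1 = ptag (fst u) (Poly_Mapping.single (snd u) 1)"
  by simp

lemma mmul_commute: "mmul lam p q = mmul lam q p"
  by (rule pmul_commute) (simp add: mixable_shuffle_def add.commute quasi_shuffle_commute)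

lemma mmul_assoc: "mmul lam (mmul lam p q) r = mmul lam p (mmul lam q r)"
  by (rule pmul_assoc)
    (simp add: mixable_shuffle_def single_pair_conv_ptag mmul_ptag quasi_shuffle_assoc add.assoc
      del: ptag_linear(3))

text \<open>On pure tensors both sides have the unit as first factor, and the second factors agree
  by \<open>qmul_pcons\<close>.\<close>

lemma mmul_rota_baxter:
  "mmul lam (mixable_oper p) (mixable_oper q) = mixable_oper (mmul lam (mixable_oper p) q)
     + mixable_oper (mmul lam p (mixable_oper q)) + pscale lam (mixable_oper (mmul lam p q))"
proof (rule linear_eqI[where p = p])
  fix u
  show "mmul lam (mixable_oper (Poly_Mapping.single u 1)) (mixable_oper q)
     = mixable_oper (mmul lam (mixable_oper (Poly_Mapping.single u 1)) q)
     + mixable_oper (mmul lam (Poly_Mapping.single u 1) (mixable_oper q))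
     + pscale lam (mixable_oper (mmul lam (Poly_Mapping.single u 1) q))"
  proof (rule linear_eqI[where p = q])
    fix v
    show "mmul lam (mixable_oper (Poly_Mapping.single u 1)) (mixable_oper (Poly_Mapping.single v 1))
     = mixable_oper (mmul lam (mixable_oper (Poly_Mapping.single u 1)) (Poly_Mapping.single v 1))
     + mixable_oper (mmul lam (Poly_Mapping.single u 1) (mixable_oper (Poly_Mapping.single v 1)))
     + pscale lam (mixable_oper (mmul lam (Poly_Mapping.single u 1) (Poly_Mapping.single v 1)))"
      by (simp add: single_pair_conv_ptag[of u] single_pair_conv_ptag[of v] mmul_ptag qmul_pcons
          add_ac del: ptag_linear(3) mixable_oper_linear(3) pcons_linear(3))
  qed (simp_all add: pmul_linear pscale_add algebra_simps)
qed (simp_all add: pmul_linear pscale_add algebra_simps)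


subsection \<open>Operated algebras and their quotients\<close>

locale comm_operated_algebra = nonunital_comm_algebra K A
  for K (structure) and A :: "('k, 'a, 'm) operated_algebra_scheme" (structure) +
  assumes oper_closed: "x \<in> carrier A \<Longrightarrow> oper A x \<in> carrier A"
    and oper_add: "\<lbrakk>x \<in> carrier A; y \<in> carrier A\<rbrakk>
      \<Longrightarrow> oper A (x \<oplus>\<^bsub>A\<^esub> y) = oper A x \<oplus>\<^bsub>A\<^esub> oper A y"
    and oper_smult: "\<lbrakk>c \<in> carrier K; x \<in> carrier A\<rbrakk>
      \<Longrightarrow> oper A (c \<odot>\<^bsub>A\<^esub> x) = c \<odot>\<^bsub>A\<^esub> oper A x"

lemma comm_operated_algebra_of_rota_baxter:
  "comm_rota_baxter_algebra K R lam \<Longrightarrow> comm_operated_algebra K R"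
  unfolding comm_rota_baxter_algebra_def comm_rota_baxter_algebra_axioms_def
    comm_operated_algebra_def comm_operated_algebra_axioms_def
  by blast

lemma (in nonunital_comm_algebra) alg_r_distr:
  "\<lbrakk>x \<in> carrier A; y \<in> carrier A; z \<in> carrier A\<rbrakk>
    \<Longrightarrow> z \<otimes>\<^bsub>A\<^esub> (x \<oplus>\<^bsub>A\<^esub> y) = (z \<otimes>\<^bsub>A\<^esub> x) \<oplus>\<^bsub>A\<^esub> (z \<otimes>\<^bsub>A\<^esub> y)"
  using alg_l_distr[of x y z] alg_m_comm[of z] by simp

lemma (in nonunital_comm_algebra) alg_smult_assoc2:
  "\<lbrakk>c \<in> carrier K; x \<in> carrier A; y \<in> carrier A\<rbrakk>
    \<Longrightarrow> x \<otimes>\<^bsub>A\<^esub> (c \<odot>\<^bsub>A\<^esub> y) = c \<odot>\<^bsub>A\<^esub> (x \<otimes>\<^bsub>A\<^esub> y)"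
  using alg_smult_assoc[of c y x] alg_m_comm[of x] by simp

lemma (in nonunital_comm_algebra) alg_m_zero [simp]:
  "x \<in> carrier A \<Longrightarrow> \<zero>\<^bsub>A\<^esub> \<otimes>\<^bsub>A\<^esub> x = \<zero>\<^bsub>A\<^esub>"
  "x \<in> carrier A \<Longrightarrow> x \<otimes>\<^bsub>A\<^esub> \<zero>\<^bsub>A\<^esub> = \<zero>\<^bsub>A\<^esub>"
  using alg_smult_assoc[of "\<zero>" "\<zero>\<^bsub>A\<^esub>" x] alg_smult_assoc2[of "\<zero>" x "\<zero>\<^bsub>A\<^esub>"]
  by (simp_all add: alg_m_closed)

lemma (in comm_operated_algebra) oper_zero [simp]: "oper A \<zero>\<^bsub>A\<^esub> = \<zero>\<^bsub>A\<^esub>"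
  using oper_smult[of "\<zero>" "\<zero>\<^bsub>A\<^esub>"] oper_closed[of "\<zero>\<^bsub>A\<^esub>"] by simp

lemma (in comm_operated_algebra) operated_ideal_carrier: "operated_ideal K A (carrier A)"
  unfolding operated_ideal_def using carrier_is_submodule alg_m_closed oper_closed by blast

lemma (in comm_operated_algebra) operated_ideal_gen:
  assumes "S \<subseteq> carrier A"
  shows "operated_ideal K A (gen_operated_ideal K A S)"
proof -
  let ?F = "{I. operated_ideal K A I \<and> S \<subseteq> I}"
  \<comment> \<open>An empty family would have the whole type as its intersection; the carrier is a
    member.\<close>
  have ne: "carrier A \<in> ?F" using assms operated_ideal_carrier by simp
  have sub: "submodule I K A" if "I \<in> ?F" for I using that by (simp add: operated_ideal_def)
  have "submodule (\<Inter>?F) K A"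
  proof (rule submoduleI)
    show "\<Inter>?F \<subseteq> carrier A" using ne by blast
    show "\<zero>\<^bsub>A\<^esub> \<in> \<Inter>?F"
      using subgroup.one_closed[OF submodule.axioms(1)[OF sub]] by simp
    show "\<ominus>\<^bsub>A\<^esub> a \<in> \<Inter>?F" if "a \<in> \<Inter>?F" for a
      using submoduleE(3)[OF sub] that by blast
    show "a \<oplus>\<^bsub>A\<^esub> b \<in> \<Inter>?F" if "a \<in> \<Inter>?F" "b \<in> \<Inter>?F" for a b
      using submoduleE(5)[OF sub] that by blast
    show "a \<odot>\<^bsub>A\<^esub> x \<in> \<Inter>?F" if "a \<in> carrier K" "x \<in> \<Inter>?F" for a x
      using submoduleE(4)[OF sub] that by blast
  qed
  then show ?thesis
    unfolding gen_operated_ideal_def operated_ideal_def by (auto simp: operated_ideal_def)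
qed

lemma gen_operated_ideal_superset: "S \<subseteq> gen_operated_ideal K A S"
  unfolding gen_operated_ideal_def by blast

lemma gen_operated_ideal_least:
  "operated_ideal K A I \<Longrightarrow> S \<subseteq> I \<Longrightarrow> gen_operated_ideal K A S \<subseteq> I"
  unfolding gen_operated_ideal_def by blast

section \<open>Quotients by an operated ideal\<close>

locale operated_quotient = comm_operated_algebra K A
  for K (structure) and A :: "('k, 'a, 'm) operated_algebra_scheme" (structure) +
  fixes I :: "'a set"
  assumes operated_ideal: "operated_ideal K A I"
begin

abbreviation "proj x \<equiv> I +>\<^bsub>A\<^esub> x"
abbreviation "Q \<equiv> quotient_algebra A I"

lemma ideal_submodule: "submodule I K A"
  using operated_ideal by (simp add: operated_ideal_def)

sublocale abelian_subgroup I A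
  by (rule abelian_subgroupI3[OF additive_subgroup.intro])
    (use ideal_submodule submodule.axioms(1) M.abelian_group_axioms in auto)

lemma ideal_closed:
  "h \<in> I \<Longrightarrow> h \<in> carrier A"
  "\<lbrakk>c \<in> carrier K; h \<in> I\<rbrakk> \<Longrightarrow> c \<odot>\<^bsub>A\<^esub> h \<in> I"
  "\<lbrakk>h \<in> I; x \<in> carrier A\<rbrakk> \<Longrightarrow> x \<otimes>\<^bsub>A\<^esub> h \<in> I"
  "\<lbrakk>h \<in> I; x \<in> carrier A\<rbrakk> \<Longrightarrow> h \<otimes>\<^bsub>A\<^esub> x \<in> I"
  "h \<in> I \<Longrightarrow> oper A h \<in> I"
  using operated_ideal a_subset submodule.smult_closed[OF ideal_submodule]
  by (auto simp: operated_ideal_def)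

lemma proj_absorb: "\<lbrakk>h \<in> I; x \<in> carrier A\<rbrakk> \<Longrightarrow> proj (h \<oplus>\<^bsub>A\<^esub> x) = proj x"
  using M.a_repr_independence[of "h \<oplus>\<^bsub>A\<^esub> x" I x] M.a_rcosI[of h I x] a_subset a_subgroup by auto

lemma proj_eqD:
  assumes "x \<in> carrier A" "y \<in> carrier A" "proj x = proj y"
  obtains h where "h \<in> I" "x = h \<oplus>\<^bsub>A\<^esub> y"
  using a_rcos_self[OF assms(1)] assms(3) unfolding a_r_coset_def' by auto

lemma proj_ideal: "h \<in> I \<Longrightarrow> proj h = I"
  using M.a_coset_join2[of h I] a_subgroup ideal_closed(1) by blast

text \<open>Evaluates the operations on cosets, which are unions over representatives: the union
  collapses when its terms coincide, and a coset is nonempty because \<open>I\<close> contains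
  zero.\<close>

lemma UN_proj:
  assumes "\<And>h. h \<in> I \<Longrightarrow> G (h \<oplus>\<^bsub>A\<^esub> x) = B"
  shows "(\<Union>u\<in>proj x. G u) = B"
  unfolding a_r_coset_def'[of A I x] using assms zero_closed by blast

lemma carrier_Q: "carrier Q = proj ` carrier A"
  unfolding quotient_algebra_def A_RCOSETS_def' by auto

lemma proj_closed: "x \<in> carrier A \<Longrightarrow> proj x \<in> carrier Q"
  by (simp add: carrier_Q)

lemma zero_Q: "\<zero>\<^bsub>Q\<^esub> = proj \<zero>\<^bsub>A\<^esub>"
  using proj_ideal[OF zero_closed] by (simp add: quotient_algebra_def)

lemma proj_add:
  "\<lbrakk>x \<in> carrier A; y \<in> carrier A\<rbrakk> \<Longrightarrow> proj x \<oplus>\<^bsub>Q\<^esub> proj y = proj (x \<oplus>\<^bsub>A\<^esub> y)"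
  by (simp add: quotient_algebra_def a_rcos_sum)

lemma proj_smult:
  assumes "c \<in> carrier K" "x \<in> carrier A"
  shows "c \<odot>\<^bsub>Q\<^esub> proj x = proj (c \<odot>\<^bsub>A\<^esub> x)"
proof -
  have "(\<Union>u\<in>proj x. proj (c \<odot>\<^bsub>A\<^esub> u)) = proj (c \<odot>\<^bsub>A\<^esub> x)"
    by (rule UN_proj) (use assms in \<open>simp add: smult_r_distr ideal_closed proj_absorb\<close>)
  then show ?thesis by (simp add: quotient_algebra_def)
qed

lemma proj_oper:
  assumes "x \<in> carrier A"
  shows "oper Q (proj x) = proj (oper A x)"
proof -
  have "(\<Union>u\<in>proj x. proj (oper A u)) = proj (oper A x)"
    by (rule UN_proj)
      (use assms in \<open>simp add: oper_add oper_closed ideal_closed(1,5) proj_absorb\<close>)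
  then show ?thesis by (simp add: quotient_algebra_def)
qed

lemma proj_mult:
  assumes x: "x \<in> carrier A" and y: "y \<in> carrier A"
  shows "proj x \<otimes>\<^bsub>Q\<^esub> proj y = proj (x \<otimes>\<^bsub>A\<^esub> y)"
proof -
  \<comment> \<open>The inner union is evaluated for a fixed representative
    \<open>h \<oplus> x\<close> of the first coset; the outer one is then constant.\<close>
  have "(\<Union>v\<in>proj y. proj ((h \<oplus>\<^bsub>A\<^esub> x) \<otimes>\<^bsub>A\<^esub> v)) = proj (x \<otimes>\<^bsub>A\<^esub> y)" if h: "h \<in> I" for h
  proof (rule UN_proj)
    fix k assume k: "k \<in> I"
    have mem: "h \<in> carrier A" "k \<in> carrier A" using h k by (auto intro: ideal_closed)
    have "(h \<oplus>\<^bsub>A\<^esub> x) \<otimes>\<^bsub>A\<^esub> (k \<oplus>\<^bsub>A\<^esub> y)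
        = (h \<otimes>\<^bsub>A\<^esub> (k \<oplus>\<^bsub>A\<^esub> y)) \<oplus>\<^bsub>A\<^esub> ((x \<otimes>\<^bsub>A\<^esub> k) \<oplus>\<^bsub>A\<^esub> (x \<otimes>\<^bsub>A\<^esub> y))"
      using alg_l_distr[of h x "k \<oplus>\<^bsub>A\<^esub> y"] alg_r_distr[of k y x] mem x y by simp
    then show "proj ((h \<oplus>\<^bsub>A\<^esub> x) \<otimes>\<^bsub>A\<^esub> (k \<oplus>\<^bsub>A\<^esub> y)) = proj (x \<otimes>\<^bsub>A\<^esub> y)"
      using mem x y h k by (simp add: proj_absorb ideal_closed alg_m_closed)
  qed
  then have "(\<Union>u\<in>proj x. \<Union>v\<in>proj y. proj (u \<otimes>\<^bsub>A\<^esub> v)) = proj (x \<otimes>\<^bsub>A\<^esub> y)"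
    by (rule UN_proj)
  then show ?thesis by (simp add: quotient_algebra_def rcoset_mult_def)
qed

lemmas proj_simps = proj_closed zero_Q proj_add proj_smult proj_mult proj_oper

lemma abelian_group_Q: "abelian_group Q"
proof (rule abelian_groupI)
  fix x assume "x \<in> carrier Q"
  then obtain a where a: "a \<in> carrier A" "x = proj a" by (auto simp: carrier_Q)
  then have "proj (\<ominus>\<^bsub>A\<^esub> a) \<oplus>\<^bsub>Q\<^esub> x = \<zero>\<^bsub>Q\<^esub>"
    by (simp add: proj_simps M.l_neg)
  then show "\<exists>y\<in>carrier Q. y \<oplus>\<^bsub>Q\<^esub> x = \<zero>\<^bsub>Q\<^esub>" using a proj_closed M.a_inv_closed by blast
qed (auto simp: carrier_Q proj_simps M.a_assoc, auto simp: M.a_comm)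

lemma comm_operated_algebra_Q: "comm_operated_algebra K Q"
proof (intro comm_operated_algebra.intro nonunital_comm_algebra.intro moduleI)
  show "nonunital_comm_algebra_axioms K Q"
    by unfold_locales
      (auto simp: carrier_Q proj_simps alg_m_closed alg_m_assoc alg_l_distr alg_smult_assoc,
        auto simp: alg_m_comm)
  show "comm_operated_algebra_axioms K Q"
    by unfold_locales (auto simp: carrier_Q proj_simps oper_closed oper_add oper_smult)
qed (auto simp: carrier_Q proj_simps smult_l_distr smult_r_distr smult_assoc1 R.is_cring
  intro!: abelian_group_Q)

text \<open>The identity modulo \<open>I\<close> is required in the form of an equality up to a
  summand \<open>h\<close>, the shape that \<open>proj_absorb\<close> removes.\<close>

lemma comm_rota_baxter_algebra_Q:
  assumes "lam \<in> carrier K"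
    and rb: "\<And>u v. \<lbrakk>u \<in> carrier A; v \<in> carrier A\<rbrakk> \<Longrightarrow> \<exists>h\<in>I. oper A u \<otimes>\<^bsub>A\<^esub> oper A v =
      h \<oplus>\<^bsub>A\<^esub> (oper A (oper A u \<otimes>\<^bsub>A\<^esub> v) \<oplus>\<^bsub>A\<^esub> oper A (u \<otimes>\<^bsub>A\<^esub> oper A v)
            \<oplus>\<^bsub>A\<^esub> lam \<odot>\<^bsub>A\<^esub> oper A (u \<otimes>\<^bsub>A\<^esub> v))"
  shows "comm_rota_baxter_algebra K Q lam"
proof -
  interpret Q: comm_operated_algebra K Q by (rule comm_operated_algebra_Q)
  show ?thesis
  proof (unfold_locales, goal_cases)
    \<comment> \<open>The fifth goal is \<open>rota_baxter\<close>; it is checked on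
      representatives.\<close>
    case (5 u v)
    then obtain a b where ab: "a \<in> carrier A" "b \<in> carrier A" "u = proj a" "v = proj b"
      by (auto simp: carrier_Q)
    obtain h where "h \<in> I" and h: "oper A a \<otimes>\<^bsub>A\<^esub> oper A b =
      h \<oplus>\<^bsub>A\<^esub> (oper A (oper A a \<otimes>\<^bsub>A\<^esub> b) \<oplus>\<^bsub>A\<^esub> oper A (a \<otimes>\<^bsub>A\<^esub> oper A b)
            \<oplus>\<^bsub>A\<^esub> lam \<odot>\<^bsub>A\<^esub> oper A (a \<otimes>\<^bsub>A\<^esub> b))"
      using rb ab(1,2) by blast
    then show ?case
      using ab assms(1) by (simp add: proj_simps oper_closed alg_m_closed proj_absorb)
  qed (use assms(1) Q.oper_closed Q.oper_add Q.oper_smult in auto)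
qed

end


subsection \<open>Operated words and the free operated algebra\<close>

lemma free_comm_semigroup_mono: "Y \<subseteq> Z \<Longrightarrow> free_comm_semigroup Y \<subseteq> free_comm_semigroup Z"
  by (auto simp: free_comm_semigroup_def)

lemma Q_stage_mono: "m \<le> n \<Longrightarrow> Q_stage X m \<subseteq> Q_stage X n"
proof (rule lift_Suc_mono_le[of "Q_stage X"])
  show "Q_stage X n \<subseteq> Q_stage X (Suc n)" for n
  proof (induction n)
    case (Suc n)
    have "Var ` X \<union> Op ` Q_stage X n \<subseteq> Var ` X \<union> Op ` Q_stage X (Suc n)"
      using Suc.IH by (intro Un_mono image_mono order_refl)
    then show ?case
      using free_comm_semigroup_mono by (metis Q_stage.simps(2))
  qed (simp add: free_comm_semigroup_mono)
qed

text \<open>Replaces the stages by a fixed point equation. A word has finitely many letters, so one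
  stage, the maximum of theirs, contains all their arguments.\<close>

lemma Q_words_iff: "w \<in> Q_words X \<longleftrightarrow> w \<noteq> {#} \<and> set_mset w \<subseteq> Var ` X \<union> Op ` Q_words X"
proof
  assume "w \<in> Q_words X"
  then obtain n where n: "w \<in> Q_stage X n" by (auto simp: Q_words_def)
  show "w \<noteq> {#} \<and> set_mset w \<subseteq> Var ` X \<union> Op ` Q_words X"
  proof (cases n)
    case (Suc m)
    have "Q_stage X m \<subseteq> Q_words X" by (auto simp: Q_words_def)
    then have "Var ` X \<union> Op ` Q_stage X m \<subseteq> Var ` X \<union> Op ` Q_words X"
      by (intro Un_mono image_mono order_refl)
    moreover have "w \<in> free_comm_semigroup (Var ` X \<union> Op ` Q_stage X m)" using n Suc by simp
    ultimately have "w \<in> free_comm_semigroup (Var ` X \<union> Op ` Q_words X)"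
      using free_comm_semigroup_mono by blast
    then show ?thesis by (simp add: free_comm_semigroup_def)
  qed (use n in \<open>auto simp: free_comm_semigroup_def\<close>)
next
  assume w: "w \<noteq> {#} \<and> set_mset w \<subseteq> Var ` X \<union> Op ` Q_words X"
  have "\<exists>n. L \<subseteq> Var ` X \<union> Op ` Q_stage X n"
    if "finite L" "L \<subseteq> Var ` X \<union> Op ` Q_words X" for L
    using that
  proof (induction L)
    case (insert l L)
    obtain n where n: "L \<subseteq> Var ` X \<union> Op ` Q_stage X n" using insert by auto
    obtain m where m: "l \<in> Var ` X \<union> Op ` Q_stage X m" using insert.prems by (auto simp: Q_words_def)
    have mono: "Var ` X \<union> Op ` Q_stage X i \<subseteq> Var ` X \<union> Op ` Q_stage X (max m n)" if "i \<le> max m n" for i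
      by (intro Un_mono image_mono Q_stage_mono order_refl that)
    have "insert l L \<subseteq> Var ` X \<union> Op ` Q_stage X (max m n)"
      using subset_trans[OF n mono] subsetD[OF mono m] by simp
    then show ?case by (rule exI)
  qed simp
  then obtain n where "set_mset w \<subseteq> Var ` X \<union> Op ` Q_stage X n" using w finite_set_mset by metis
  then have "w \<in> Q_stage X (Suc n)" using w by (simp add: free_comm_semigroup_def)
  then show "w \<in> Q_words X" by (auto simp: Q_words_def simp del: Q_stage.simps)
qed

lemma var_word_Q: "x \<in> X \<Longrightarrow> var_word x \<in> Q_words X"
  by (subst Q_words_iff) (auto simp: var_word_def)

lemma op_word_Q: "u \<in> Q_words X \<Longrightarrow> op_word u \<in> Q_words X"
  by (subst Q_words_iff) (auto simp: op_word_def)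

lemma add_Q: "\<lbrakk>u \<in> Q_words X; v \<in> Q_words X\<rbrakk> \<Longrightarrow> u + v \<in> Q_words X"
  unfolding Q_words_iff[of u] Q_words_iff[of v] Q_words_iff[of "u + v"] by auto

lemma Q_words_nonempty: "w \<in> Q_words X \<Longrightarrow> w \<noteq> {#}"
  using Q_words_iff by blast

lemma single_letter_Q: "{#l#} \<in> Q_words X \<longleftrightarrow> l \<in> Var ` X \<union> Op ` Q_words X"
  by (subst Q_words_iff) simp

text \<open>Q(X) is generated from X by P and products. The proof is an induction on the stage with
  an induction over the letters of a word inside.\<close>

lemma Q_words_induct [consumes 1, case_names var oper add]:
  assumes "w \<in> Q_words X"
    and var: "\<And>x. x \<in> X \<Longrightarrow> P (var_word x)"
    and oper: "\<And>u. u \<in> Q_words X \<Longrightarrow> P u \<Longrightarrow> P (op_word u)"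
    and add: "\<And>u v. \<lbrakk>u \<in> Q_words X; v \<in> Q_words X; P u; P v\<rbrakk> \<Longrightarrow> P (u + v)"
  shows "P w"
proof -
  \<comment> \<open>The letter-by-letter part, for any set \<open>L\<close> of letters already
    settled, so that it serves stage 0 and the later stages alike.\<close>
  have words: "P w" if "w \<noteq> {#}" "set_mset w \<subseteq> L"
    and L: "\<And>l. l \<in> L \<Longrightarrow> {#l#} \<in> Q_words X \<and> P {#l#}" for w and L
    using that(1,2)
  proof (induction w)
    case (add l w)
    have l: "{#l#} \<in> Q_words X" "P {#l#}" using L add.prems by auto
    show ?case
    proof (cases "w = {#}")
      case False
      have "l' \<in> Var ` X \<union> Op ` Q_words X" if "l' \<in># w" for l'
        using that add.prems(2) L[of l'] single_letter_Q[of l' X] by auto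
      then have "w \<in> Q_words X"
        using False Q_words_iff[of w X] by blast
      then show ?thesis using assms(4)[OF l(1) _ l(2), of w] add False by simp
    qed (use l in simp)
  qed simp
  have "P w" if "w \<in> Q_stage X n" for n
    using that
  proof (induction n arbitrary: w)
    case 0
    have "{#l#} \<in> Q_words X \<and> P {#l#}" if "l \<in> Var ` X" for l
      using that var var_word_Q unfolding var_word_def by (elim imageE) simp
    then show ?case
      using words[of w "Var ` X"] 0 by (simp add: free_comm_semigroup_def)
  next
    case (Suc n)
    have "{#l#} \<in> Q_words X \<and> P {#l#}" if "l \<in> Var ` X \<union> Op ` Q_stage X n" for l
      using that
    proof
      assume "l \<in> Op ` Q_stage X n"
      then obtain u where u: "l = Op u" "u \<in> Q_stage X n" by blast
      then have "u \<in> Q_words X" by (auto simp: Q_words_def)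
      then show ?thesis
        using u Suc.IH oper[of u] op_word_Q[of u] by (simp add: op_word_def)
    next
      assume "l \<in> Var ` X"
      then show ?thesis
        using var var_word_Q unfolding var_word_def by (elim imageE) simp
    qed
    then show ?case using words[of w "Var ` X \<union> Op ` Q_stage X n"] Suc.prems
      by (simp add: free_comm_semigroup_def)
  qed
  then show ?thesis using assms(1) by (auto simp: Q_words_def)
qed

section \<open>The coefficient ring and the operations on polynomials in words\<close>

lemma scalar_ring_simps [simp]:
  "carrier scalar_ring = UNIV" "\<zero>\<^bsub>scalar_ring\<^esub> = 0" "\<one>\<^bsub>scalar_ring\<^esub> = 1"
  "a \<oplus>\<^bsub>scalar_ring\<^esub> b = a + b" "a \<otimes>\<^bsub>scalar_ring\<^esub> b = a * b"
  by (simp_all add: scalar_ring_def)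

lemma cring_scalar_ring: "cring scalar_ring"
proof (rule cringI)
  show "abelian_group scalar_ring"
    by (rule abelian_groupI) (auto simp: algebra_simps intro: exI[of _ "- _"])
  show "comm_monoid scalar_ring"
    by (rule comm_monoidI) (auto simp: algebra_simps)
qed (auto simp: algebra_simps)

text \<open>\<open>poly_scale\<close> acts on polynomials in words only; \<open>pscale\<close>
  allows any index type, as the polynomials in lists and pairs require.\<close>

lemma poly_scale_eq: "poly_scale = pscale"
  by (intro ext) (simp add: poly_scale_def pscale_def)

lemma poly_oper_eq: "poly_oper p = plin (\<lambda>w. word_poly (op_word w)) p"
  by (simp add: poly_oper_def plin_def word_poly_def)

lemma poly_oper_linear [simp]:
  "poly_oper (p + q) = poly_oper p + poly_oper q"
  "poly_oper (pscale c p) = pscale c (poly_oper p)"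
  "poly_oper (Poly_Mapping.single w c) = Poly_Mapping.single (op_word w) c"
  by (simp_all add: poly_oper_eq word_poly_def)

lemma free_operated_algebra_simps [simp]:
  "p \<in> carrier (free_operated_algebra X) \<longleftrightarrow> Poly_Mapping.keys p \<subseteq> Q_words X"
  "p \<otimes>\<^bsub>free_operated_algebra X\<^esub> q = p * q" "p \<oplus>\<^bsub>free_operated_algebra X\<^esub> q = p + q"
  "\<zero>\<^bsub>free_operated_algebra X\<^esub> = 0" "c \<odot>\<^bsub>free_operated_algebra X\<^esub> p = pscale c p"
  "oper (free_operated_algebra X) p = poly_oper p"
  by (simp_all add: free_operated_algebra_def poly_scale_eq)

lemma pscale_mult: "pscale c (p * q) = pscale c p * (q :: 'a::monoid_add \<Rightarrow>\<^sub>0 'k::{comm_ring, comm_monoid_mult})"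
  by (simp add: pscale_def mult_map_scale_conv_mult mult.assoc)

lemma keys_poly_oper: "Poly_Mapping.keys p \<subseteq> Q_words X \<Longrightarrow> Poly_Mapping.keys (poly_oper p) \<subseteq> Q_words X"
proof (induction p rule: keys_subset_induct)
  case (single_add w c p)
  have "Poly_Mapping.keys (Poly_Mapping.single (op_word w) c) \<subseteq> Q_words X"
    using single_add.hyps op_word_Q by auto
  then show ?case
    using single_add keys_add[of "Poly_Mapping.single (op_word w) c" "poly_oper p"] by auto
qed (simp add: poly_oper_eq)

lemma keys_mult_Q:
  assumes "Poly_Mapping.keys p \<subseteq> Q_words X" "Poly_Mapping.keys q \<subseteq> Q_words X"
  shows "Poly_Mapping.keys (p * q) \<subseteq> Q_words X"
  using assms keys_mult[of p q] add_Q by blast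

lemma keys_add_subset:
  "\<lbrakk>Poly_Mapping.keys p \<subseteq> W; Poly_Mapping.keys q \<subseteq> W\<rbrakk> \<Longrightarrow> Poly_Mapping.keys (p + q) \<subseteq> W"
  using keys_add[of p q] by blast

lemma keys_pscale_subset: "Poly_Mapping.keys p \<subseteq> W \<Longrightarrow> Poly_Mapping.keys (pscale c p) \<subseteq> W"
  by (rule subset_trans[OF keys_pscale])

lemma comm_operated_algebra_free:
  "comm_operated_algebra scalar_ring (free_operated_algebra X)"
proof (intro comm_operated_algebra.intro nonunital_comm_algebra.intro moduleI)
  show "abelian_group (free_operated_algebra X)"
    by (rule abelian_groupI)
      (auto simp: keys_add_subset add.assoc add.commute intro!: bexI[of _ "- _"])
  show "nonunital_comm_algebra_axioms scalar_ring (free_operated_algebra X)"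
    by (rule nonunital_comm_algebra_axioms.intro)
      (simp_all add: keys_mult_Q pscale_mult algebra_simps)
  show "comm_operated_algebra_axioms scalar_ring (free_operated_algebra X)"
    by unfold_locales (simp_all add: keys_poly_oper)
qed (simp_all add: keys_add_subset keys_pscale_subset pscale_add pscale_add_left cring_scalar_ring)


subsection \<open>Linear extension into a module\<close>

text \<open>Counterpart of \<open>plin\<close> for targets that are records with a carrier, as the
  test algebras and the quotient are.\<close>

definition lin_ext :: "('k, 'r, 'm) module_scheme \<Rightarrow> ('a \<Rightarrow> 'r) \<Rightarrow> ('a \<Rightarrow>\<^sub>0 'k::zero) \<Rightarrow> 'r"
  where "lin_ext M e p = (\<Oplus>\<^bsub>M\<^esub>w\<in>Poly_Mapping.keys p. Poly_Mapping.lookup p w \<odot>\<^bsub>M\<^esub> e w)"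

locale scalar_module = module scalar_ring M
  for M :: "('k::{comm_ring, comm_monoid_mult}, 'r, 'm) module_scheme" (structure)
begin

lemma scalar_closed [simp]: "x \<in> carrier M \<Longrightarrow> c \<odot> x \<in> carrier M"
  using smult_closed[of c x] by simp

lemma scalar_zero [simp]: "x \<in> carrier M \<Longrightarrow> 0 \<odot> x = \<zero>"
  using smult_l_null[of x] by simp

lemma scalar_one [simp]: "x \<in> carrier M \<Longrightarrow> 1 \<odot> x = x"
  using smult_one[of x] by simp

lemma scalar_add: "x \<in> carrier M \<Longrightarrow> (a + b) \<odot> x = a \<odot> x \<oplus> b \<odot> x"
  using smult_l_distr[of a b x] by simp

lemma scalar_mult: "x \<in> carrier M \<Longrightarrow> (a * b) \<odot> x = a \<odot> (b \<odot> x)"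
  using smult_assoc1[of a b x] by simp

text \<open>Allows several polynomials to be summed over one common index set, where coefficients
  can be compared or added.\<close>

lemma lin_ext_superset:
  assumes e: "e \<in> W \<rightarrow> carrier M" and "finite J" "J \<subseteq> W" "Poly_Mapping.keys p \<subseteq> J"
  shows "lin_ext M e p = (\<Oplus>w\<in>J. Poly_Mapping.lookup p w \<odot> e w)"
proof -
  have mem: "e w \<in> carrier M" if "w \<in> J" for w using e assms(3) that by auto
  show ?thesis
    unfolding lin_ext_def
    by (rule M.add.finprod_mono_neutral_cong_left)
      (use assms(2,4) mem in \<open>auto simp: in_keys_iff\<close>)
qed

lemma lin_ext_zero [simp]: "lin_ext M e 0 = \<zero>"
  by (simp add: lin_ext_def)

context
  fixes e :: "'a \<Rightarrow> 'r" and W :: "'a set"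
  assumes e: "e \<in> W \<rightarrow> carrier M"
begin

lemma lin_ext_closed: "Poly_Mapping.keys p \<subseteq> W \<Longrightarrow> lin_ext M e p \<in> carrier M"
  unfolding lin_ext_def using e by (intro M.finsum_closed) (auto dest!: subsetD)

lemma lin_ext_single: "w \<in> W \<Longrightarrow> lin_ext M e (Poly_Mapping.single w c) = c \<odot> e w"
  using lin_ext_superset[OF e, of "{w}" "Poly_Mapping.single w c"] e
  by (auto simp: Pi_iff)

lemma lin_ext_add:
  assumes "Poly_Mapping.keys p \<subseteq> W" "Poly_Mapping.keys q \<subseteq> W"
  shows "lin_ext M e (p + q) = lin_ext M e p \<oplus> lin_ext M e q"
proof -
  let ?J = "Poly_Mapping.keys p \<union> Poly_Mapping.keys q"
  have mem: "e w \<in> carrier M" if "w \<in> ?J" for w using e assms that by auto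
  have "lin_ext M e (p + q) = (\<Oplus>w\<in>?J. Poly_Mapping.lookup (p + q) w \<odot> e w)"
    by (rule lin_ext_superset[OF e]) (use assms keys_add[of p q] in auto)
  also have "\<dots> = (\<Oplus>w\<in>?J. Poly_Mapping.lookup p w \<odot> e w \<oplus> Poly_Mapping.lookup q w \<odot> e w)"
    by (rule M.finsum_cong') (use mem in \<open>auto simp: lookup_add scalar_add\<close>)
  also have "\<dots> = (\<Oplus>w\<in>?J. Poly_Mapping.lookup p w \<odot> e w) \<oplus> (\<Oplus>w\<in>?J. Poly_Mapping.lookup q w \<odot> e w)"
    by (rule M.finsum_addf) (use mem in auto)
  also have "\<dots> = lin_ext M e p \<oplus> lin_ext M e q"
    using lin_ext_superset[OF e, of ?J p] lin_ext_superset[OF e, of ?J q] assms by simp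
  finally show ?thesis .
qed

lemma lin_ext_pscale:
  assumes "Poly_Mapping.keys p \<subseteq> W"
  shows "lin_ext M e (pscale c p) = c \<odot> lin_ext M e p"
proof -
  have mem: "e w \<in> carrier M" if "w \<in> Poly_Mapping.keys p" for w using e assms that by auto
  have "lin_ext M e (pscale c p) = (\<Oplus>w\<in>Poly_Mapping.keys p. Poly_Mapping.lookup (pscale c p) w \<odot> e w)"
    by (rule lin_ext_superset[OF e]) (use assms keys_pscale[of c p] in auto)
  also have "\<dots> = (\<Oplus>w\<in>Poly_Mapping.keys p. c \<odot> (Poly_Mapping.lookup p w \<odot> e w))"
    by (rule M.finsum_cong') (use mem in \<open>auto simp: scalar_mult\<close>)
  also have "\<dots> = c \<odot> lin_ext M e p"
    unfolding lin_ext_def using mem by (intro finsum_smult_ldistr[symmetric]) auto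
  finally show ?thesis .
qed

end

end


subsection \<open>Evaluation of operated words\<close>

text \<open>
  The empty product is represented by \<^const>\<open>None\<close>, since there is no unit. The junk values
  outside the carrier make the operation commute unconditionally.
\<close>

definition opt_mult :: "('r, 'm) ring_scheme \<Rightarrow> 'r \<Rightarrow> 'r option \<Rightarrow> 'r option"
  where "opt_mult R x z = (if x \<in> carrier R
    then (case z of None \<Rightarrow> Some x | Some y \<Rightarrow> Some (if y \<in> carrier R then x \<otimes>\<^bsub>R\<^esub> y else y))
    else z)"

definition mset_prod :: "('r, 'm) ring_scheme \<Rightarrow> 'r multiset \<Rightarrow> 'r"
  where "mset_prod R N = the (fold_mset (opt_mult R) None N)"

primrec letter_eval :: "('k, 'r, 'm) operated_algebra_scheme \<Rightarrow> ('x \<Rightarrow> 'r) \<Rightarrow> 'x letter \<Rightarrow> 'r"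
  where
    "letter_eval R f (Var x) = f x"
  | "letter_eval R f (Op u) = oper R (mset_prod R (image_mset (letter_eval R f) u))"

definition word_eval :: "('k, 'r, 'm) operated_algebra_scheme \<Rightarrow> ('x \<Rightarrow> 'r) \<Rightarrow> 'x word \<Rightarrow> 'r"
  where "word_eval R f w = mset_prod R (image_mset (letter_eval R f) w)"

section \<open>Products over nonempty multisets without a unit\<close>

context nonunital_comm_algebra
begin

lemma opt_mult_commute: "comp_fun_commute (opt_mult A)"
proof
  fix x y
  have lcomm: "y \<otimes>\<^bsub>A\<^esub> (x \<otimes>\<^bsub>A\<^esub> w) = x \<otimes>\<^bsub>A\<^esub> (y \<otimes>\<^bsub>A\<^esub> w)"
    if "x \<in> carrier A" "y \<in> carrier A" "w \<in> carrier A" for w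
    using that alg_m_assoc[of x y w] alg_m_assoc[of y x w] alg_m_comm[of x y] by simp
  have "opt_mult A y (opt_mult A x z) = opt_mult A x (opt_mult A y z)" for z
    using alg_m_comm[of x y]
    by (cases "x \<in> carrier A"; cases "y \<in> carrier A"; cases z)
      (simp_all add: opt_mult_def alg_m_closed lcomm)
  then show "opt_mult A y \<circ> opt_mult A x = opt_mult A x \<circ> opt_mult A y"
    by (simp add: fun_eq_iff)
qed

interpretation opt_mult: comp_fun_commute "opt_mult A"
  by (rule opt_mult_commute)

lemma opt_mult_simps [simp]:
  "x \<in> carrier A \<Longrightarrow> opt_mult A x None = Some x"
  "\<lbrakk>x \<in> carrier A; y \<in> carrier A\<rbrakk> \<Longrightarrow> opt_mult A x (Some y) = Some (x \<otimes>\<^bsub>A\<^esub> y)"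
  by (simp_all add: opt_mult_def)

text \<open>The conjunct about a start value \<open>Some z\<close> is what yields multiplicativity:
  a fold over a sum of multisets is a fold over one, started at the result of the other.\<close>

lemma fold_opt_mult:
  assumes "N \<noteq> {#}" "set_mset N \<subseteq> carrier A"
  shows "\<exists>y\<in>carrier A. fold_mset (opt_mult A) None N = Some y \<and>
    (\<forall>z\<in>carrier A. fold_mset (opt_mult A) (Some z) N = Some (y \<otimes>\<^bsub>A\<^esub> z))"
  using assms
proof (induction N)
  case (add x N)
  show ?case
  proof (cases "N = {#}")
    case False
    then obtain y where "y \<in> carrier A" "fold_mset (opt_mult A) None N = Some y"
      "\<forall>z\<in>carrier A. fold_mset (opt_mult A) (Some z) N = Some (y \<otimes>\<^bsub>A\<^esub> z)"
      using add by auto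
    then show ?thesis
      using add.prems by (intro bexI[of _ "x \<otimes>\<^bsub>A\<^esub> y"]) (simp_all add: alg_m_closed alg_m_assoc)
  qed (use add.prems in simp)
qed simp

lemma mset_prod_single [simp]: "x \<in> carrier A \<Longrightarrow> mset_prod A {#x#} = x"
  by (simp add: mset_prod_def)

lemma mset_prod_closed:
  "\<lbrakk>N \<noteq> {#}; set_mset N \<subseteq> carrier A\<rbrakk> \<Longrightarrow> mset_prod A N \<in> carrier A"
  using fold_opt_mult[of N] by (auto simp: mset_prod_def)

lemma mset_prod_add:
  assumes "N \<noteq> {#}" "set_mset N \<subseteq> carrier A" "N' \<noteq> {#}" "set_mset N' \<subseteq> carrier A"
  shows "mset_prod A (N + N') = mset_prod A N \<otimes>\<^bsub>A\<^esub> mset_prod A N'"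
  using fold_opt_mult[OF assms(1,2)] fold_opt_mult[OF assms(3,4)]
  using alg_m_comm by (auto simp: mset_prod_def)

end

locale word_evaluation = comm_operated_algebra scalar_ring R
  for R :: "('k::{comm_ring, comm_monoid_mult}, 'r, 'm) operated_algebra_scheme" (structure) +
  fixes X :: "'x set" and f :: "'x \<Rightarrow> 'r"
  assumes f: "f \<in> X \<rightarrow> carrier R"
begin

sublocale scalar_module R
  by unfold_locales

text \<open>Closure is needed letter by letter, because \<open>mset_prod\<close> behaves as a
  product only when all factors lie in the carrier.\<close>

lemma letter_eval_closed: "w \<in> Q_words X \<Longrightarrow> set_mset (image_mset (letter_eval R f) w) \<subseteq> carrier R"
proof (induction rule: Q_words_induct)
  case (oper u)
  then show ?case
    by (simp add: op_word_def Q_words_nonempty mset_prod_closed oper_closed)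
qed (use f in \<open>auto simp: var_word_def\<close>)

lemma word_eval_closed: "w \<in> Q_words X \<Longrightarrow> word_eval R f w \<in> carrier R"
  unfolding word_eval_def
  by (rule mset_prod_closed[OF _ letter_eval_closed]) (auto dest: Q_words_nonempty)

lemma word_eval_Pi: "word_eval R f \<in> Q_words X \<rightarrow> carrier R"
  using word_eval_closed by blast

lemma word_eval_var [simp]: "x \<in> X \<Longrightarrow> word_eval R f (var_word x) = f x"
  using funcset_mem[OF f] by (simp add: word_eval_def var_word_def)

lemma word_eval_op [simp]: "u \<in> Q_words X \<Longrightarrow> word_eval R f (op_word u) = oper R (word_eval R f u)"
  using oper_closed[OF word_eval_closed[of u]] by (simp add: word_eval_def op_word_def)

lemma word_eval_add [simp]:
  "\<lbrakk>u \<in> Q_words X; v \<in> Q_words X\<rbrakk>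
    \<Longrightarrow> word_eval R f (u + v) = word_eval R f u \<otimes> word_eval R f v"
  unfolding word_eval_def image_mset_union
  by (rule mset_prod_add[OF _ letter_eval_closed _ letter_eval_closed])
    (auto dest: Q_words_nonempty)

abbreviation "poly_eval \<equiv> lin_ext R (word_eval R f)"

lemmas poly_eval_closed = lin_ext_closed[OF word_eval_Pi]
lemmas poly_eval_single = lin_ext_single[OF word_eval_Pi]
lemmas poly_eval_add = lin_ext_add[OF word_eval_Pi]
lemmas poly_eval_pscale = lin_ext_pscale[OF word_eval_Pi]

lemma poly_eval_word: "w \<in> Q_words X \<Longrightarrow> poly_eval (word_poly w) = word_eval R f w"
  by (simp add: word_poly_def poly_eval_single word_eval_closed)

lemma keys_single_Q: "w \<in> Q_words X \<Longrightarrow> Poly_Mapping.keys (Poly_Mapping.single w c) \<subseteq> Q_words X"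
  by auto

lemma poly_eval_mult:
  assumes "Poly_Mapping.keys p \<subseteq> Q_words X" "Poly_Mapping.keys q \<subseteq> Q_words X"
  shows "poly_eval (p * q) = poly_eval p \<otimes> poly_eval q"
  using assms(1)
proof (induction p rule: keys_subset_induct)
  case zero
  show ?case using poly_eval_closed[OF assms(2)] by (simp)
next
  case (single_add u c p)
  have mono: "poly_eval (Poly_Mapping.single u c * q) = poly_eval (Poly_Mapping.single u c) \<otimes> poly_eval q"
    using assms(2)
  proof (induction q rule: keys_subset_induct)
    case zero
    show ?case using poly_eval_closed[OF keys_single_Q[OF single_add.hyps(1)]]
      by (simp)
  next
    case (single_add v d q)
    note uv = \<open>u \<in> Q_words X\<close> \<open>v \<in> Q_words X\<close>
    have "poly_eval (Poly_Mapping.single u c * Poly_Mapping.single v d)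
        = poly_eval (Poly_Mapping.single u c) \<otimes> poly_eval (Poly_Mapping.single v d)"
      using uv alg_smult_assoc[of c "word_eval R f u" "d \<odot> word_eval R f v"]
        alg_smult_assoc2[of d "word_eval R f u" "word_eval R f v"]
      by (simp add: mult_single poly_eval_single add_Q word_eval_closed scalar_mult alg_m_closed)
    then show ?case
      using uv single_add.hyps single_add.IH
      by (simp add: distrib_left poly_eval_add keys_mult_Q keys_single_Q keys_add_subset
          alg_r_distr poly_eval_closed)
  qed
  then show ?case
    using single_add assms(2)
    by (simp add: distrib_right poly_eval_add keys_mult_Q keys_single_Q alg_l_distr poly_eval_closed)
qed

lemma poly_eval_oper:
  assumes "Poly_Mapping.keys p \<subseteq> Q_words X"
  shows "poly_eval (poly_oper p) = oper R (poly_eval p)"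
  using assms
proof (induction p rule: keys_subset_induct)
  case zero
  show ?case by (simp add: poly_oper_eq)
next
  case (single_add u c p)
  then show ?case
    using oper_smult[of c "word_eval R f u"] word_eval_closed[of u]
    by (simp add: poly_eval_add poly_eval_single keys_single_Q op_word_Q keys_poly_oper oper_add
        poly_eval_closed)
qed

text \<open>Because the kernel is an operated ideal, minimality of the generated ideal reduces
  vanishing on \<open>rb_ideal\<close> to vanishing on the relations.\<close>

lemma operated_ideal_kernel:
  "operated_ideal scalar_ring (free_operated_algebra X)
    {p \<in> carrier (free_operated_algebra X). poly_eval p = \<zero>}" (is "operated_ideal _ ?A ?N")
proof -
  interpret A: comm_operated_algebra scalar_ring ?A by (rule comm_operated_algebra_free)
  have "submodule ?N scalar_ring ?A"
  proof (rule A.submoduleI)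
    fix a assume a: "a \<in> ?N"
    then have cl: "\<ominus>\<^bsub>?A\<^esub> a \<in> carrier ?A" by (intro A.M.a_inv_closed) simp
    \<comment> \<open>The inverse in the record is known only through its defining property, so its
      value is obtained by evaluating this sum.\<close>
    have "a + \<ominus>\<^bsub>?A\<^esub> a = 0" using A.M.r_neg[of a] a by simp
    then have "poly_eval (\<ominus>\<^bsub>?A\<^esub> a) = \<zero>"
      using poly_eval_add[of a "\<ominus>\<^bsub>?A\<^esub> a"] a cl poly_eval_closed[of "\<ominus>\<^bsub>?A\<^esub> a"]
      by (simp)
    then show "\<ominus>\<^bsub>?A\<^esub> a \<in> ?N" using cl by simp
  next
    show "?N \<subseteq> carrier ?A" by blast
  qed (simp_all add: poly_eval_add poly_eval_pscale keys_add_subset keys_pscale_subset)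
  then show ?thesis
    unfolding operated_ideal_def
    by (simp add: poly_eval_mult poly_eval_oper keys_mult_Q keys_poly_oper poly_eval_closed)
qed

end

section \<open>Vanishing of the Rota-Baxter relations under evaluation\<close>

lemma word_poly_add: "word_poly (u + v) = word_poly u * word_poly v"
  by (simp add: word_poly_def mult_single)

lemma word_poly_op: "word_poly (op_word u) = poly_oper (word_poly u)"
  by (simp add: word_poly_def)

lemma keys_word_poly: "w \<in> Q_words X \<Longrightarrow> Poly_Mapping.keys (word_poly w) \<subseteq> Q_words X"
  by (auto simp: word_poly_def)

lemma keys_diff_subset:
  fixes p q :: "'a \<Rightarrow>\<^sub>0 'k::{comm_ring, comm_monoid_mult}"
  assumes "Poly_Mapping.keys p \<subseteq> W" "Poly_Mapping.keys q \<subseteq> W"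
  shows "Poly_Mapping.keys (p - q) \<subseteq> W"
  using assms unfolding subset_iff in_keys_iff lookup_minus by (metis diff_self)

lemma rb_relations_closed: "rb_relations lam X \<subseteq> carrier (free_operated_algebra X)"
  unfolding rb_relations_def
proof (clarify, unfold free_operated_algebra_simps poly_scale_eq)
  fix u v assume "u \<in> Q_words X" "v \<in> Q_words X"
  then show "Poly_Mapping.keys (word_poly (op_word u + op_word v) - word_poly (op_word (op_word u + v))
       - word_poly (op_word (u + op_word v)) - pscale lam (word_poly (op_word (u + v)))) \<subseteq> Q_words X"
    by (intro keys_diff_subset keys_pscale_subset keys_word_poly add_Q op_word_Q)
qed

locale rb_evaluation = word_evaluation R X f + comm_rota_baxter_algebra scalar_ring R lam
  for R :: "('k::{comm_ring, comm_monoid_mult}, 'r, 'm) operated_algebra_scheme" (structure)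
    and lam :: 'k and X :: "'x set" and f :: "'x \<Rightarrow> 'r"
begin

lemma poly_eval_relation:
  assumes "u \<in> Q_words X" "v \<in> Q_words X"
  shows "poly_eval (word_poly (op_word u + op_word v) - word_poly (op_word (op_word u + v))
       - word_poly (op_word (u + op_word v)) - poly_scale lam (word_poly (op_word (u + v)))) = \<zero>"
    (is "poly_eval ?r = _")
proof -
  \<comment> \<open>Evaluation is known to respect sums but not differences. So \<open>?r\<close> is
    completed by \<open>?s\<close> to the product word, and the value of \<open>?s\<close>, which
    equals that of the product word, is cancelled.\<close>
  let ?s = "word_poly (op_word (op_word u + v)) + word_poly (op_word (u + op_word v))
     + pscale lam (word_poly (op_word (u + v)))"
  note Q = assms op_word_Q[OF assms(1)] op_word_Q[OF assms(2)] add_Q op_word_Q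
  have s: "Poly_Mapping.keys ?s \<subseteq> Q_words X"
    by (intro keys_add_subset keys_pscale_subset keys_word_poly Q)
  have t: "Poly_Mapping.keys (word_poly (op_word u + op_word v)) \<subseteq> Q_words X"
    by (intro keys_word_poly Q)
  have "Poly_Mapping.keys ?r \<subseteq> Q_words X"
    unfolding poly_scale_eq
    by (intro keys_diff_subset keys_pscale_subset keys_word_poly Q)
  moreover have "poly_eval ?s = poly_eval (word_poly (op_word u + op_word v))"
    using rota_baxter[of "word_eval R f u" "word_eval R f v"]
    by (simp add: poly_eval_add poly_eval_pscale poly_eval_word Q word_eval_closed keys_word_poly
        keys_add_subset keys_pscale_subset)
  moreover have "?r + ?s = word_poly (op_word u + op_word v)"
    by (simp add: poly_scale_eq)
  ultimately show ?thesis
    using poly_eval_add[of ?r ?s] s poly_eval_closed[of ?r] poly_eval_closed[OF s] by simp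
qed

lemma poly_eval_rb_ideal:
  assumes "p \<in> rb_ideal lam X"
  shows "poly_eval p = \<zero>"
proof -
  let ?A = "free_operated_algebra X :: ('k, 'x word \<Rightarrow>\<^sub>0 'k) operated_algebra"
  have "rb_relations lam X \<subseteq> {p \<in> carrier ?A. poly_eval p = \<zero>}"
  proof
    fix r assume "r \<in> rb_relations lam X"
    then show "r \<in> {p \<in> carrier ?A. poly_eval p = \<zero>}"
      using poly_eval_relation subsetD[OF rb_relations_closed, of r lam X]
      by (auto simp: rb_relations_def simp del: free_operated_algebra_simps)
  qed
  then have "rb_ideal lam X \<subseteq> {p \<in> carrier ?A. poly_eval p = \<zero>}"
    unfolding rb_ideal_def by (rule gen_operated_ideal_least[OF operated_ideal_kernel])
  then show ?thesis using assms by blast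
qed

end


subsection \<open>The universal property\<close>

locale rb_free =
  fixes lam :: "'k::{comm_ring, comm_monoid_mult}" and X :: "'x set"
begin

abbreviation FA :: "('k, 'x word \<Rightarrow>\<^sub>0 'k) operated_algebra"
  where "FA \<equiv> free_operated_algebra X"

sublocale FA: comm_operated_algebra scalar_ring FA
  by (rule comm_operated_algebra_free)

sublocale quot: operated_quotient scalar_ring FA "rb_ideal lam X"
  by unfold_locales
    (simp add: rb_ideal_def FA.operated_ideal_gen rb_relations_closed)

lemma rb_quotient_eq: "quot.Q = rb_quotient lam X"
  by (simp add: rb_quotient_def)

lemma rb_class_eq: "rb_class lam X w = quot.proj (word_poly w)"
  by (simp add: rb_class_def)

text \<open>The relations in S are its values on pairs of words.\<close>

definition rb_defect :: "('x word \<Rightarrow>\<^sub>0 'k) \<Rightarrow> ('x word \<Rightarrow>\<^sub>0 'k) \<Rightarrow> ('x word \<Rightarrow>\<^sub>0 'k)"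
  where "rb_defect p q = poly_oper p * poly_oper q - poly_oper (poly_oper p * q)
    - poly_oper (p * poly_oper q) - pscale lam (poly_oper (p * q))"

lemma pscale_mult_right: "pscale c (p * q) = p * pscale c (q :: 'x word \<Rightarrow>\<^sub>0 'k)"
  using pscale_mult[of c q p] by (simp add: mult.commute)

lemma pscale_diff: "pscale c (p - q) = pscale c p - pscale c (q :: 'x word \<Rightarrow>\<^sub>0 'k)"
  by (rule poly_mapping_eqI) (simp add: lookup_minus right_diff_distrib)

lemma rb_defect_linear:
  "rb_defect (p + p') q = rb_defect p q + rb_defect p' q"
  "rb_defect p (q + q') = rb_defect p q + rb_defect p q'"
  "rb_defect (pscale c p) q = pscale c (rb_defect p q)"
  "rb_defect p (pscale c q) = pscale c (rb_defect p q)"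
  by (simp_all add: rb_defect_def pscale_add pscale_diff pscale_mult[symmetric] pscale_mult_right[symmetric]
      mult.commute[of c] distrib_left distrib_right)

lemma rb_defect_zero: "rb_defect 0 q = 0" "rb_defect p 0 = 0"
  using rb_defect_linear(3)[of 0 0 q] rb_defect_linear(4)[of p 0 0] by simp_all

text \<open>S imposes the identity on words only. Since \<open>rb_defect\<close> is bilinear and the
  ideal is closed under linear combinations, it spreads to all polynomials.\<close>

lemma rb_defect_ideal:
  assumes "Poly_Mapping.keys p \<subseteq> Q_words X" "Poly_Mapping.keys q \<subseteq> Q_words X"
  shows "rb_defect p q \<in> rb_ideal lam X"
proof -
  have add: "a + b \<in> rb_ideal lam X" if "a \<in> rb_ideal lam X" "b \<in> rb_ideal lam X" for a b
    using quot.a_closed[OF that] by simp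
  have scale: "pscale c a \<in> rb_ideal lam X" if "a \<in> rb_ideal lam X" for c a
    using quot.ideal_closed(2)[OF _ that, of c] by simp
  have zero: "0 \<in> rb_ideal lam X" using quot.zero_closed by simp
  have words: "rb_defect (word_poly u) (word_poly v) \<in> rb_ideal lam X"
    if "u \<in> Q_words X" "v \<in> Q_words X" for u v
  proof -
    have "rb_defect (word_poly u) (word_poly v) \<in> rb_relations lam X"
      unfolding rb_relations_def rb_defect_def
      using that by (auto simp: word_poly_add word_poly_op poly_scale_eq)
    then show ?thesis unfolding rb_ideal_def by (rule subsetD[OF gen_operated_ideal_superset])
  qed
  show ?thesis
    using assms(1)
  proof (induction p rule: keys_subset_induct)
    case (single_add u c p)
    have "rb_defect (word_poly u) q \<in> rb_ideal lam X"
      using assms(2)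
    proof (induction q rule: keys_subset_induct)
      case (single_add v d q)
      then show ?case
        using words[OF \<open>u \<in> Q_words X\<close>, of v] single_conv_pscale[of v d]
        by (simp add: word_poly_def rb_defect_linear add scale del: pscale_single)
    qed (simp add: rb_defect_zero zero)
    then show ?case
      using single_add single_conv_pscale[of u c]
      by (simp add: word_poly_def rb_defect_linear add scale del: pscale_single)
  qed (simp add: rb_defect_zero zero)
qed

lemma comm_rota_baxter_algebra_rb_quotient:
  "comm_rota_baxter_algebra scalar_ring (rb_quotient lam X) lam"
  unfolding rb_quotient_eq[symmetric]
proof (rule quot.comm_rota_baxter_algebra_Q)
  fix p q assume "p \<in> carrier FA" "q \<in> carrier FA"
  then have "rb_defect p q \<in> rb_ideal lam X" by (simp add: rb_defect_ideal)
  then show "\<exists>h\<in>rb_ideal lam X. oper FA p \<otimes>\<^bsub>FA\<^esub> oper FA q =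
      h \<oplus>\<^bsub>FA\<^esub> (oper FA (oper FA p \<otimes>\<^bsub>FA\<^esub> q) \<oplus>\<^bsub>FA\<^esub> oper FA (p \<otimes>\<^bsub>FA\<^esub> oper FA q)
        \<oplus>\<^bsub>FA\<^esub> lam \<odot>\<^bsub>FA\<^esub> oper FA (p \<otimes>\<^bsub>FA\<^esub> q))"
    by (rule bexI[rotated]) (simp add: rb_defect_def)
qed simp

lemma proj_rb_quotient:
  assumes "Poly_Mapping.keys p \<subseteq> Q_words X"
  shows "quot.proj p \<in> carrier (rb_quotient lam X)"
    and "c \<odot>\<^bsub>rb_quotient lam X\<^esub> quot.proj p = quot.proj (pscale c p)"
    and "oper (rb_quotient lam X) (quot.proj p) = quot.proj (poly_oper p)"
  using assms quot.proj_closed[of p] quot.proj_smult[of c p] quot.proj_oper[of p]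
  by (simp_all add: rb_quotient_eq)

lemma proj_rb_quotient_add_mult:
  assumes "Poly_Mapping.keys p \<subseteq> Q_words X" "Poly_Mapping.keys q \<subseteq> Q_words X"
  shows "quot.proj p \<oplus>\<^bsub>rb_quotient lam X\<^esub> quot.proj q = quot.proj (p + q)"
    and "quot.proj p \<otimes>\<^bsub>rb_quotient lam X\<^esub> quot.proj q = quot.proj (p * q)"
  using assms quot.proj_add[of p q] quot.proj_mult[of p q]
  by (simp_all add: rb_quotient_eq)

lemmas rb_quotient_simps = proj_rb_quotient proj_rb_quotient_add_mult

lemma zero_rb_quotient: "\<zero>\<^bsub>rb_quotient lam X\<^esub> = quot.proj 0"
  using quot.zero_Q by (simp add: rb_quotient_eq)

lemma rb_quotient_cases:
  assumes "U \<in> carrier (rb_quotient lam X)"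
  obtains p where "Poly_Mapping.keys p \<subseteq> Q_words X" "U = quot.proj p"
  using assms unfolding rb_quotient_eq[symmetric] quot.carrier_Q by auto

lemma rb_quotient_module: "scalar_module (rb_quotient lam X)"
  using comm_rota_baxter_algebra_rb_quotient
  by (simp add: scalar_module_def comm_rota_baxter_algebra_def nonunital_comm_algebra_def)

lemma rb_class_closed: "rb_class lam X \<in> Q_words X \<rightarrow> carrier (rb_quotient lam X)"
  by (rule funcsetI) (simp add: rb_class_eq rb_quotient_simps(1) keys_word_poly)

text \<open>Translates between sums in the quotient and cosets of polynomials, in both directions:
  for spanning and for independence.\<close>

lemma rb_class_lin_ext:
  assumes "Poly_Mapping.keys p \<subseteq> Q_words X"
  shows "lin_ext (rb_quotient lam X) (rb_class lam X) p = quot.proj p"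
proof -
  interpret Q: scalar_module "rb_quotient lam X" by (rule rb_quotient_module)
  show ?thesis
    using assms
  proof (induction p rule: keys_subset_induct)
    case zero
    show ?case by (simp add: zero_rb_quotient)
  next
    case (single_add w c p)
    have w: "Poly_Mapping.keys (Poly_Mapping.single w c) \<subseteq> Q_words X" using single_add.hyps by auto
    have "c \<odot>\<^bsub>rb_quotient lam X\<^esub> rb_class lam X w = quot.proj (Poly_Mapping.single w c)"
      using rb_quotient_simps(2)[of "word_poly w" c] keys_word_poly[OF single_add.hyps(1)]
      by (simp add: rb_class_eq word_poly_def)
    then show ?case
      using single_add w
      by (simp add: Q.lin_ext_add[OF rb_class_closed] Q.lin_ext_single[OF rb_class_closed]
          rb_quotient_simps)
  qed
qed

end

section \<open>The homomorphism induced on the quotient\<close>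

locale rb_free_evaluation = rb_evaluation R lam X f + rb_free lam X
  for R :: "('k::{comm_ring, comm_monoid_mult}, 'r, 'm) operated_algebra_scheme" (structure)
    and lam :: 'k and X :: "'x set" and f :: "'x \<Rightarrow> 'r"
begin

lemma poly_eval_proj_cong:
  assumes "Poly_Mapping.keys p \<subseteq> Q_words X" "Poly_Mapping.keys q \<subseteq> Q_words X"
    and "quot.proj p = quot.proj q"
  shows "poly_eval p = poly_eval q"
proof -
  obtain h where h: "h \<in> rb_ideal lam X" "p = h + q"
    using quot.proj_eqD[of p q] assms by auto
  have "Poly_Mapping.keys h \<subseteq> Q_words X" using quot.ideal_closed(1)[OF h(1)] by simp
  then show ?thesis
    using h poly_eval_rb_ideal[OF h(1)] poly_eval_closed[OF assms(2)] assms(2)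
    by (simp add: poly_eval_add)
qed

text \<open>The choice of representative is immaterial by \<open>poly_eval_proj_cong\<close>;
  \<open>restrict\<close> supplies the extensionality demanded by the universal property.\<close>

definition quotient_eval :: "('x word \<Rightarrow>\<^sub>0 'k) set \<Rightarrow> 'r"
  where "quotient_eval = restrict
    (\<lambda>U. poly_eval (SOME p. Poly_Mapping.keys p \<subseteq> Q_words X \<and> U = quot.proj p))
    (carrier (rb_quotient lam X))"

lemma quotient_eval_proj:
  assumes "Poly_Mapping.keys p \<subseteq> Q_words X"
  shows "quotient_eval (quot.proj p) = poly_eval p"
proof -
  let ?q = "SOME q. Poly_Mapping.keys q \<subseteq> Q_words X \<and> quot.proj p = quot.proj q"
  have "Poly_Mapping.keys ?q \<subseteq> Q_words X \<and> quot.proj p = quot.proj ?q"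
    by (rule someI[where x = p]) (use assms in simp)
  then show ?thesis
    using poly_eval_proj_cong[OF assms, of ?q] rb_quotient_simps(1)[OF assms]
    by (simp add: quotient_eval_def)
qed

lemma quotient_eval_hom: "quotient_eval \<in> rb_hom scalar_ring (rb_quotient lam X) R"
  unfolding rb_hom_def
  by (auto elim!: rb_quotient_cases simp: rb_quotient_simps quotient_eval_proj poly_eval_closed
      poly_eval_add poly_eval_mult poly_eval_pscale poly_eval_oper
      keys_add_subset keys_mult_Q keys_pscale_subset keys_poly_oper simp del: in_keys_iff)

lemma quotient_eval_var: "x \<in> X \<Longrightarrow> quotient_eval (rb_class lam X (var_word x)) = f x"
  by (simp add: rb_class_eq quotient_eval_proj keys_word_poly var_word_Q poly_eval_word)

text \<open>The uniqueness half: \<open>g\<close> respects P and products, which generate all words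
  from X, and is linear.\<close>

lemma hom_eq_poly_eval:
  assumes g: "g \<in> rb_hom scalar_ring (rb_quotient lam X) R"
    and var: "\<And>x. x \<in> X \<Longrightarrow> g (rb_class lam X (var_word x)) = f x"
    and p: "Poly_Mapping.keys p \<subseteq> Q_words X"
  shows "g (quot.proj p) = poly_eval p"
proof -
  have proj: "quot.proj q \<in> carrier (rb_quotient lam X)" if "Poly_Mapping.keys q \<subseteq> Q_words X" for q
    using rb_quotient_simps(1)[OF that] .
  have g_closed: "g (quot.proj q) \<in> carrier R" if "Poly_Mapping.keys q \<subseteq> Q_words X" for q
    using g proj[OF that] by (auto simp: rb_hom_def)
  have g_add: "g (quot.proj (q + r)) = g (quot.proj q) \<oplus> g (quot.proj r)"
    and g_mult: "g (quot.proj (q * r)) = g (quot.proj q) \<otimes> g (quot.proj r)"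
    if "Poly_Mapping.keys q \<subseteq> Q_words X" "Poly_Mapping.keys r \<subseteq> Q_words X" for q r
    using g proj[OF that(1)] proj[OF that(2)]
    unfolding proj_rb_quotient_add_mult[OF that, symmetric] rb_hom_def by auto
  have g_scale: "g (quot.proj (pscale c q)) = c \<odot> g (quot.proj q)"
    and g_oper: "g (quot.proj (poly_oper q)) = oper R (g (quot.proj q))"
    if "Poly_Mapping.keys q \<subseteq> Q_words X" for c q
    using g proj[OF that] unfolding proj_rb_quotient(2,3)[OF that, symmetric] rb_hom_def by auto
  have word: "g (quot.proj (word_poly w)) = word_eval R f w" if "w \<in> Q_words X" for w
    using that
  proof (induction rule: Q_words_induct)
    case (var x)
    then show ?case using assms(2)[OF var] by (simp add: rb_class_eq)
  next
    case (oper u)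
    then show ?case using g_oper[OF keys_word_poly[OF oper.hyps]] by (simp add: word_poly_op)
  next
    case (add u v)
    then show ?case
      using g_mult[OF keys_word_poly keys_word_poly, of u v] by (simp add: word_poly_add)
  qed
  show ?thesis
    using p
  proof (induction p rule: keys_subset_induct)
    case zero
    \<comment> \<open>Membership in \<open>rb_hom\<close> does not mention zero; scaling by 0
      provides it.\<close>
    show ?case using g_scale[of 0 0] g_closed[of 0] by simp
  next
    case (single_add w c p)
    have "g (quot.proj (Poly_Mapping.single w c)) = c \<odot> word_eval R f w"
      using g_scale[OF keys_word_poly[OF single_add.hyps(1)], of c] word[OF single_add.hyps(1)]
      by (simp add: word_poly_def)
    then show ?case
      using single_add g_add[OF keys_single_Q, of w p c]
      by (simp add: poly_eval_add keys_single_Q poly_eval_single)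
  qed
qed

lemma ex1_quotient_hom:
  "\<exists>!h. h \<in> rb_hom scalar_ring (rb_quotient lam X) R \<inter> extensional (carrier (rb_quotient lam X)) \<and>
    (\<forall>x\<in>X. h (rb_class lam X (var_word x)) = f x)"
proof (rule ex1I[of _ quotient_eval])
  show "quotient_eval \<in> rb_hom scalar_ring (rb_quotient lam X) R
      \<inter> extensional (carrier (rb_quotient lam X)) \<and>
    (\<forall>x\<in>X. quotient_eval (rb_class lam X (var_word x)) = f x)"
    using quotient_eval_hom quotient_eval_var by (simp add: quotient_eval_def)
next
  fix g assume g: "g \<in> rb_hom scalar_ring (rb_quotient lam X) R
      \<inter> extensional (carrier (rb_quotient lam X)) \<and>
    (\<forall>x\<in>X. g (rb_class lam X (var_word x)) = f x)"
  show "g = quotient_eval"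
  proof (rule extensionalityI[of _ "carrier (rb_quotient lam X)"])
    fix U assume "U \<in> carrier (rb_quotient lam X)"
    then show "g U = quotient_eval U"
      using hom_eq_poly_eval[of g] g quotient_eval_proj by (metis IntD1 rb_quotient_cases)
  qed (use g in \<open>auto simp: quotient_eval_def\<close>)
qed

end

lemma rb_quotient_free:
  fixes lam :: "'k::{comm_ring, comm_monoid_mult}" and X :: "'x set"
  shows "free_comm_rota_baxter_algebra TYPE('r) scalar_ring lam X
    (rb_quotient lam X) (\<lambda>x. rb_class lam X (var_word x))"
proof -
  interpret rb_free lam X .
  show ?thesis
    unfolding free_comm_rota_baxter_algebra_def
  proof (intro conjI allI impI)
    show "comm_rota_baxter_algebra scalar_ring (rb_quotient lam X) lam"
      by (rule comm_rota_baxter_algebra_rb_quotient)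
    show "(\<lambda>x. rb_class lam X (var_word x)) \<in> X \<rightarrow> carrier (rb_quotient lam X)"
      by (rule funcsetI) (rule funcset_mem[OF rb_class_closed var_word_Q])
  next
    fix R :: "('k, 'r) operated_algebra" and f
    assume *: "comm_rota_baxter_algebra scalar_ring R lam \<and> f \<in> X \<rightarrow> carrier R"
    then interpret rb_free_evaluation R lam X f
      by (intro rb_free_evaluation.intro rb_evaluation.intro word_evaluation.intro
          word_evaluation_axioms.intro) (auto intro: comm_operated_algebra_of_rota_baxter)
    show "\<exists>!h. h \<in> rb_hom scalar_ring (rb_quotient lam X) R \<inter> extensional (carrier (rb_quotient lam X)) \<and>
      (\<forall>x\<in>X. h (rb_class lam X (var_word x)) = f x)"
      by (rule ex1_quotient_hom)
  qed
qed


subsection \<open>Spanning by the normal forms\<close>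

text \<open>An empty prefix \<open>a\<close> unites the shapes P(v) and u P(v), so that products
  need only one nontrivial case.\<close>

lemma Phi_stage_cases:
  assumes "w \<in> Phi_stage X n"
  obtains "w \<in> free_comm_semigroup (Var ` X)"
  | a v m where "n = Suc m" "v \<in> Phi_stage X m" "w = a + op_word v"
      "a = {#} \<or> a \<in> free_comm_semigroup (Var ` X)"
  using assms by (cases n) fastforce+

lemma Phi_stageI:
  assumes "v \<in> Phi_stage X n" "a = {#} \<or> a \<in> free_comm_semigroup (Var ` X)"
  shows "a + op_word v \<in> Phi_stage X (Suc n)"
  using assms by auto

lemma free_comm_semigroup_subset_Q: "free_comm_semigroup (Var ` X) \<subseteq> Q_words X"
  using UN_upper[of 0 UNIV "Q_stage X"] by (simp add: Q_words_def)

lemma free_comm_semigroup_add: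
  "\<lbrakk>u \<in> free_comm_semigroup Y; v \<in> free_comm_semigroup Y\<rbrakk> \<Longrightarrow> u + v \<in> free_comm_semigroup Y"
  by (simp add: free_comm_semigroup_def)

lemma Phi_stage_subset_Q: "Phi_stage X n \<subseteq> Q_words X"
proof (induction n)
  case (Suc n)
  show ?case
  proof
    fix w assume "w \<in> Phi_stage X (Suc n)"
    then show "w \<in> Q_words X"
    proof (cases rule: Phi_stage_cases)
      case 1
      then show ?thesis by (rule subsetD[OF free_comm_semigroup_subset_Q])
    next
      case (2 a v m)
      then have "op_word v \<in> Q_words X" using Suc.IH op_word_Q by auto
      then show ?thesis
        using 2(3,4) add_Q[OF subsetD[OF free_comm_semigroup_subset_Q], of a X "op_word v"] by auto
    qed
  qed
qed (simp add: free_comm_semigroup_subset_Q)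

lemma Phi_words_subset_Q: "Phi_words X \<subseteq> Q_words X"
  unfolding Phi_words_def using Phi_stage_subset_Q by blast

context rb_free
begin

lemma rb_ideal_closed:
  "0 \<in> rb_ideal lam X"
  "\<lbrakk>p \<in> rb_ideal lam X; q \<in> rb_ideal lam X\<rbrakk> \<Longrightarrow> p + q \<in> rb_ideal lam X"
  "p \<in> rb_ideal lam X \<Longrightarrow> pscale c p \<in> rb_ideal lam X"
  "\<lbrakk>Poly_Mapping.keys q \<subseteq> Q_words X; p \<in> rb_ideal lam X\<rbrakk> \<Longrightarrow> q * p \<in> rb_ideal lam X"
  "p \<in> rb_ideal lam X \<Longrightarrow> poly_oper p \<in> rb_ideal lam X"
  using quot.zero_closed quot.a_closed[of p q] quot.ideal_closed(5)[of p]
    quot.ideal_closed(2)[where c = c and h = p]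
    quot.ideal_closed(3)[where h = p and x = q]
  by simp_all

text \<open>The preimage in the free operated algebra of the span of the images of Phi(X). Working
  there replaces cosets by congruences.\<close>

definition Phi_span :: "('x word \<Rightarrow>\<^sub>0 'k) set"
  where "Phi_span = {p. Poly_Mapping.keys p \<subseteq> Q_words X \<and>
    (\<exists>q. Poly_Mapping.keys q \<subseteq> Phi_words X \<and> p - q \<in> rb_ideal lam X)}"

lemma Phi_spanI:
  "\<lbrakk>Poly_Mapping.keys p \<subseteq> Q_words X; Poly_Mapping.keys q \<subseteq> Phi_words X; p - q \<in> rb_ideal lam X\<rbrakk>
    \<Longrightarrow> p \<in> Phi_span"
  by (auto simp: Phi_span_def)

lemma Phi_span_keys: "p \<in> Phi_span \<Longrightarrow> Poly_Mapping.keys p \<subseteq> Q_words X"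
  by (simp add: Phi_span_def)

lemma Phi_span_cong:
  assumes "p \<in> Phi_span" "p' - p \<in> rb_ideal lam X" "Poly_Mapping.keys p' \<subseteq> Q_words X"
  shows "p' \<in> Phi_span"
proof -
  obtain q where "Poly_Mapping.keys q \<subseteq> Phi_words X" "p - q \<in> rb_ideal lam X"
    using assms(1) by (auto simp: Phi_span_def)
  then show ?thesis
    using assms(3) rb_ideal_closed(2)[OF assms(2), of "p - q"] by (auto simp: Phi_span_def)
qed

lemma Phi_span_Phi: "Poly_Mapping.keys p \<subseteq> Phi_words X \<Longrightarrow> p \<in> Phi_span"
  using Phi_words_subset_Q[of X] rb_ideal_closed(1) by (force simp: Phi_span_def)

lemma Phi_span_add:
  assumes "p \<in> Phi_span" "p' \<in> Phi_span"
  shows "p + p' \<in> Phi_span"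
proof -
  obtain q q' where q: "Poly_Mapping.keys q \<subseteq> Phi_words X" "p - q \<in> rb_ideal lam X"
    "Poly_Mapping.keys q' \<subseteq> Phi_words X" "p' - q' \<in> rb_ideal lam X"
    using assms by (auto simp: Phi_span_def)
  have "p + p' - (q + q') \<in> rb_ideal lam X"
    using rb_ideal_closed(2)[OF q(2,4)] by (simp add: algebra_simps)
  then show ?thesis
    by (rule Phi_spanI[rotated 2]) (simp_all add: keys_add_subset Phi_span_keys assms q(1,3))
qed

lemma Phi_span_pscale:
  assumes "p \<in> Phi_span"
  shows "pscale c p \<in> Phi_span"
proof -
  obtain q where q: "Poly_Mapping.keys q \<subseteq> Phi_words X" "p - q \<in> rb_ideal lam X"
    using assms by (auto simp: Phi_span_def)
  have "pscale c p - pscale c q \<in> rb_ideal lam X"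
    using rb_ideal_closed(3)[OF q(2), of c] by (simp add: pscale_diff)
  then show ?thesis
    by (rule Phi_spanI[rotated 2]) (simp_all add: keys_pscale_subset Phi_span_keys assms q(1))
qed

lemma Phi_span_single:
  assumes "word_poly w \<in> Phi_span"
  shows "Poly_Mapping.single w c \<in> Phi_span"
  using Phi_span_pscale[OF assms, of c] by (simp add: word_poly_def)

lemma Phi_span_zero: "0 \<in> Phi_span"
  by (rule Phi_span_Phi) simp

text \<open>A linear map that preserves the ideal descends to the quotient, where it has to be
  tested on normal forms only. It is applied to P and to multiplication by a fixed
  polynomial.\<close>

lemma Phi_span_linear_image:
  assumes add: "\<And>p q. F (p + q) = F p + F q" and scale: "\<And>c p. F (pscale c p) = pscale c (F p)"
    and keys: "\<And>p. Poly_Mapping.keys p \<subseteq> Q_words X \<Longrightarrow> Poly_Mapping.keys (F p) \<subseteq> Q_words X"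
    and ideal: "\<And>p. p \<in> rb_ideal lam X \<Longrightarrow> F p \<in> rb_ideal lam X"
    and word: "\<And>w. w \<in> Phi_words X \<Longrightarrow> F (word_poly w) \<in> Phi_span"
    and p: "p \<in> Phi_span"
  shows "F p \<in> Phi_span"
proof -
  obtain q where q: "Poly_Mapping.keys q \<subseteq> Phi_words X" "p - q \<in> rb_ideal lam X"
    using p by (auto simp: Phi_span_def)
  have "F q \<in> Phi_span"
    using q(1)
  proof (induction q rule: keys_subset_induct)
    case zero
    show ?case using scale[of 0 0] Phi_span_zero by simp
  next
    case (single_add w c q)
    have "F (Poly_Mapping.single w c) \<in> Phi_span"
      using scale[of c "word_poly w"] Phi_span_pscale[OF word[OF single_add.hyps(1)], of c]
      by (simp add: word_poly_def)
    then show ?case using single_add by (simp add: add Phi_span_add)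
  qed
  moreover have "F p - F q \<in> rb_ideal lam X"
    using ideal[OF q(2)] add[of "p - q" q] by simp
  ultimately show ?thesis
    using keys[OF Phi_span_keys[OF p]] by (rule Phi_span_cong)
qed

lemma word_poly_Phi_span: "w \<in> Phi_stage X n \<Longrightarrow> word_poly w \<in> Phi_span"
  by (rule Phi_span_Phi) (auto simp: word_poly_def Phi_words_def)

lemma Phi_span_oper: "p \<in> Phi_span \<Longrightarrow> poly_oper p \<in> Phi_span"
proof (rule Phi_span_linear_image[of poly_oper])
  fix w assume "w \<in> Phi_words X"
  then obtain n where "w \<in> Phi_stage X n" by (auto simp: Phi_words_def)
  then show "poly_oper (word_poly w) \<in> Phi_span"
    using word_poly_Phi_span[OF Phi_stageI[of w X n "{#}"]] by (simp add: word_poly_op)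
qed (simp_all add: keys_poly_oper rb_ideal_closed)

lemma keys_semigroup_word:
  "u \<in> free_comm_semigroup (Var ` X) \<Longrightarrow> Poly_Mapping.keys (word_poly u) \<subseteq> Q_words X"
  by (rule keys_word_poly) (rule subsetD[OF free_comm_semigroup_subset_Q])

text \<open>No rewriting occurs here: a word in the variables merely lengthens the prefix of a
  normal form.\<close>

lemma Phi_span_mult_semigroup:
  assumes u: "u \<in> free_comm_semigroup (Var ` X)" and "p \<in> Phi_span"
  shows "word_poly u * p \<in> Phi_span"
proof (rule Phi_span_linear_image[of "(*) (word_poly u)"])
  fix w assume "w \<in> Phi_words X"
  then obtain n where n: "w \<in> Phi_stage X n" by (auto simp: Phi_words_def)
  then have "\<exists>m. u + w \<in> Phi_stage X m"
  proof (cases rule: Phi_stage_cases)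
    case 1
    then have "u + w \<in> Phi_stage X 0" using u by (simp add: free_comm_semigroup_add)
    then show ?thesis by blast
  next
    case (2 a v m)
    then have "u + a \<in> free_comm_semigroup (Var ` X)" using u free_comm_semigroup_add by auto
    then show ?thesis
      using Phi_stageI[OF 2(2), of "u + a"] 2(3) by (metis add.assoc)
  qed
  then show "word_poly u * word_poly w \<in> Phi_span"
    using word_poly_Phi_span by (auto simp: word_poly_add[symmetric])
qed (use assms u in \<open>simp_all add: distrib_left pscale_mult_right keys_mult_Q keys_semigroup_word
  rb_ideal_closed\<close>)

text \<open>The measure is the sum of the stages, since in P(v') w' and v' P(w') only one factor
  drops while the other keeps its stage. The inner products may become combinations of normal forms
  of any stage; this does no harm, because \<open>Phi_span\<close> is closed under P.\<close>

lemma Phi_span_mult_stage: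
  "\<lbrakk>v \<in> Phi_stage X m; w \<in> Phi_stage X n\<rbrakk> \<Longrightarrow> word_poly (v + w) \<in> Phi_span"
proof (induction "m + n" arbitrary: m n v w rule: less_induct)
  case less
  show ?case
    using less.prems(1)
  proof (cases rule: Phi_stage_cases)
    case 1
    then show ?thesis
      using Phi_span_mult_semigroup[OF 1 word_poly_Phi_span[OF less.prems(2)]]
      by (simp add: word_poly_add)
  next
    case v: (2 a v' m')
    show ?thesis
      using less.prems(2)
    proof (cases rule: Phi_stage_cases)
      case 1
      then show ?thesis
        using Phi_span_mult_semigroup[OF 1 word_poly_Phi_span[OF less.prems(1)]]
        by (simp add: word_poly_add mult.commute)
    next
      case w: (2 b w' n')
      have op: "op_word v' \<in> Phi_stage X m" "op_word w' \<in> Phi_stage X n" using v(1,2) w(1,2) by auto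
      have Q: "v' \<in> Q_words X" "w' \<in> Q_words X" using v(2) w(2) Phi_stage_subset_Q by auto
      \<comment> \<open>The right-hand side of the Rota-Baxter identity for \<open>v'\<close> and
        \<open>w'\<close>; it differs from the product of the two P-words by an element of the
        ideal.\<close>
      let ?s = "poly_oper (word_poly (op_word v' + w')) + poly_oper (word_poly (v' + op_word w'))
        + pscale lam (poly_oper (word_poly (v' + w')))"
      have "?s \<in> Phi_span"
        by (intro Phi_span_add Phi_span_pscale Phi_span_oper less.hyps[OF _ op(1) w(2)]
            less.hyps[OF _ v(2) op(2)] less.hyps[OF _ v(2) w(2)])
          (simp_all add: v(1) w(1))
      moreover have "word_poly (op_word v' + op_word w') - ?s \<in> rb_ideal lam X"
        using rb_defect_ideal[OF keys_word_poly keys_word_poly, OF Q]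
        by (simp add: rb_defect_def word_poly_add word_poly_op diff_diff_eq)
      moreover have "Poly_Mapping.keys (word_poly (op_word v' + op_word w')) \<subseteq> Q_words X"
        by (intro keys_word_poly add_Q op_word_Q Q)
      ultimately have *: "word_poly (op_word v' + op_word w') \<in> Phi_span"
        by (rule Phi_span_cong)
      have eq: "v + w = (a + b) + (op_word v' + op_word w')" using v(3) w(3) by (simp add: ac_simps)
      \<comment> \<open>The prefixes are restored at the end; if both are empty there is nothing to
        restore.\<close>
      have "a + b = {#} \<or> a + b \<in> free_comm_semigroup (Var ` X)"
        using v(4) w(4) free_comm_semigroup_add by auto
      then show ?thesis
        using * Phi_span_mult_semigroup[OF _ *, of "a + b"] unfolding eq
        by (metis add_0 word_poly_add)
    qed
  qed
qed

lemma Phi_span_mult: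
  assumes "p \<in> Phi_span" "q \<in> Phi_span"
  shows "p * q \<in> Phi_span"
proof (rule Phi_span_linear_image[of "(*) p"])
  fix w assume w: "w \<in> Phi_words X"
  have "word_poly w * p \<in> Phi_span"
  proof (rule Phi_span_linear_image[of "(*) (word_poly w)"])
    fix v assume "v \<in> Phi_words X"
    then show "word_poly w * word_poly v \<in> Phi_span"
      using w Phi_span_mult_stage unfolding word_poly_add[symmetric] by (auto simp: Phi_words_def)
  qed (use assms(1) subsetD[OF Phi_words_subset_Q w] in
    \<open>simp_all add: distrib_left pscale_mult_right keys_mult_Q keys_word_poly rb_ideal_closed\<close>)
  then show "p * word_poly w \<in> Phi_span" by (simp add: mult.commute)
qed (use assms in \<open>simp_all add: distrib_left pscale_mult_right keys_mult_Q Phi_span_keys rb_ideal_closed\<close>)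

lemma Phi_span_Q:
  assumes "Poly_Mapping.keys p \<subseteq> Q_words X"
  shows "p \<in> Phi_span"
proof -
  have word: "word_poly w \<in> Phi_span" if "w \<in> Q_words X" for w
    using that
  proof (induction rule: Q_words_induct)
    case (var x)
    then have "var_word x \<in> Phi_stage X 0"
      by (simp add: free_comm_semigroup_def var_word_def)
    then show ?case by (rule word_poly_Phi_span)
  qed (simp_all add: word_poly_op word_poly_add Phi_span_oper Phi_span_mult)
  show ?thesis
    using assms
    by (induction p rule: keys_subset_induct)
      (simp_all add: Phi_span_zero Phi_span_add Phi_span_single word)
qed

end


subsection \<open>Independence of the normal forms\<close>

definition mixable_algebra :: "'k::{comm_ring, comm_monoid_mult}
    \<Rightarrow> ('k, 'm::comm_monoid_add \<times> 'm list \<Rightarrow>\<^sub>0 'k) operated_algebra"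
  where "mixable_algebra lam =
    \<lparr>carrier = UNIV, monoid.mult = mmul lam, one = undefined, zero = 0, add = (+),
     smult = pscale, oper = mixable_oper\<rparr>"

lemma mixable_algebra_simps [simp]:
  "carrier (mixable_algebra lam) = UNIV" "\<zero>\<^bsub>mixable_algebra lam\<^esub> = 0"
  "p \<otimes>\<^bsub>mixable_algebra lam\<^esub> q = mmul lam p q" "p \<oplus>\<^bsub>mixable_algebra lam\<^esub> q = p + q"
  "c \<odot>\<^bsub>mixable_algebra lam\<^esub> p = pscale c p" "oper (mixable_algebra lam) p = mixable_oper p"
  by (simp_all add: mixable_algebra_def)

lemma comm_rota_baxter_algebra_mixable:
  "comm_rota_baxter_algebra scalar_ring (mixable_algebra lam) lam"
proof (intro comm_rota_baxter_algebra.intro nonunital_comm_algebra.intro moduleI)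
  show "abelian_group (mixable_algebra lam)"
    by (rule abelian_groupI) (auto simp: algebra_simps intro: exI[of _ "- _"])
  show "nonunital_comm_algebra_axioms scalar_ring (mixable_algebra lam)"
    by (rule nonunital_comm_algebra_axioms.intro)
      (simp_all add: mmul_assoc pmul_linear, rule mmul_commute)
  show "comm_rota_baxter_algebra_axioms scalar_ring (mixable_algebra lam) lam"
    by (rule comm_rota_baxter_algebra_axioms.intro) (simp_all add: mmul_rota_baxter)
qed (simp_all add: pscale_add pscale_add_left cring_scalar_ring)

lemma finsum_mixable_algebra:
  assumes "finite J"
  shows "(\<Oplus>\<^bsub>mixable_algebra lam\<^esub>i\<in>J. g i) = (\<Sum>i\<in>J. g i)"
proof -
  interpret comm_rota_baxter_algebra scalar_ring "mixable_algebra lam" lam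
    by (rule comm_rota_baxter_algebra_mixable)
  show ?thesis
    using assms
  proof (induction J)
    case (insert i J)
    then show ?case using M.finsum_insert[of J i g] by simp
  qed (use M.finsum_empty[of g] in simp)
qed

text \<open>The decoding map from basis elements of the separating algebra to words. Its values need
  not lie in Phi(X): an empty multiset with an empty list gives the empty word.\<close>

fun phi_word :: "'x multiset \<Rightarrow> 'x multiset list \<Rightarrow> 'x word"
  where
    "phi_word a [] = image_mset Var a"
  | "phi_word a (b # s) = image_mset Var a + op_word (phi_word b s)"

text \<open>The value is stated together with its decoding because
  \<open>Poly_Mapping.single u 1\<close> does not determine \<open>u\<close> when 0 = 1; the
  decoding keeps distinct words at distinct \<open>u\<close> even then.\<close>

lemma Phi_words_eval:
  fixes lam :: "'k::{comm_ring, comm_monoid_mult}" and X :: "'x set"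
  assumes "w \<in> Phi_words X"
  shows "\<exists>u. w = phi_word (fst u) (snd u) \<and>
    word_eval (mixable_algebra lam) (\<lambda>x. Poly_Mapping.single ({#x#}, []) 1) w = Poly_Mapping.single u 1"
    (is "\<exists>u. _ \<and> ?ev w = _")
proof -
  interpret comm_rota_baxter_algebra scalar_ring
    "mixable_algebra lam :: ('k, 'x multiset \<times> 'x multiset list \<Rightarrow>\<^sub>0 'k) operated_algebra" lam
    by (rule comm_rota_baxter_algebra_mixable)
  interpret word_evaluation "mixable_algebra lam" X "\<lambda>x. Poly_Mapping.single ({#x#}, []) 1"
    by unfold_locales (auto simp: oper_add oper_smult)
  \<comment> \<open>The left factor has an empty list, so nothing is shuffled.\<close>
  have mmul: "mmul lam (Poly_Mapping.single (a, []) 1) (Poly_Mapping.single (b, s) 1)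
      = Poly_Mapping.single (a + b, s) 1" for a b :: "'x multiset" and s
    by (simp add: pmul_single mixable_shuffle_def)
  have vars: "?ev (image_mset Var a) = Poly_Mapping.single (a, []) 1"
    if "a \<noteq> {#}" "set_mset a \<subseteq> X" for a
    using that
  proof (induction a)
    case (add x a)
    have x: "?ev (var_word x) = Poly_Mapping.single ({#x#}, []) 1" using add.prems by simp
    show ?case
    proof (cases "a = {#}")
      case True
      then show ?thesis using x by (simp add: var_word_def)
    next
      case False
      then have "image_mset Var a \<in> free_comm_semigroup (Var ` X)"
        using add.prems by (auto simp: free_comm_semigroup_def)
      then have "image_mset Var a \<in> Q_words X" by (rule subsetD[OF free_comm_semigroup_subset_Q])
      then have "?ev (var_word x + image_mset Var a) = Poly_Mapping.single ({#x#} + a, []) 1"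
        using False add x var_word_Q[of x X] by (simp add: mmul)
      then show ?thesis by (simp add: var_word_def)
    qed
  qed simp
  have semigroup: "\<exists>a. w = image_mset Var a \<and> ?ev w = Poly_Mapping.single (a, []) 1"
    if w: "w \<in> free_comm_semigroup (Var ` X)" for w
  proof -
    \<comment> \<open>All letters of \<open>w\<close> are variables, so stripping the constructor
      \<open>Var\<close> loses nothing.\<close>
    define a where "a = image_mset (the_inv Var) w"
    have inv: "the_inv Var (Var x) = x" for x :: 'x by (rule the_inv_f_f) (simp add: inj_on_def)
    have "image_mset (\<lambda>l. Var (the_inv Var l)) w = image_mset (\<lambda>l. l) w"
      by (rule image_mset_cong) (use w in \<open>auto simp: free_comm_semigroup_def inv dest!: subsetD\<close>)
    then have "w = image_mset Var a" by (simp add: a_def multiset.map_comp comp_def)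
    moreover have "a \<noteq> {#}" "set_mset a \<subseteq> X"
      using w by (auto simp: free_comm_semigroup_def a_def inv dest!: subsetD)
    ultimately show ?thesis using vars by blast
  qed
  have "\<exists>u. w = phi_word (fst u) (snd u) \<and> ?ev w = Poly_Mapping.single u 1"
    if "w \<in> Phi_stage X n" for w n
    using that
  proof (induction n arbitrary: w)
    case 0
    then show ?case using semigroup[of w] by force
  next
    case (Suc n)
    from Suc.prems show ?case
    proof (cases rule: Phi_stage_cases)
      case 1
      then show ?thesis using semigroup[of w] by force
    next
      case (2 a v m)
      then obtain b s where v: "v = phi_word b s" "?ev v = Poly_Mapping.single (b, s) 1"
        using Suc.IH[of v] by auto
      have vQ: "v \<in> Q_words X" using 2(2) Phi_stage_subset_Q by blast
      then have op: "?ev (op_word v) = Poly_Mapping.single ({#}, b # s) 1"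
        using v(2) by simp
      show ?thesis
      proof (cases "a = {#}")
        case True
        then show ?thesis
          using 2(3) v(1) op by (intro exI[of _ "({#}, b # s)"]) simp
      next
        case False
        then have a: "a \<in> free_comm_semigroup (Var ` X)" using 2(4) by simp
        then obtain a' where a': "a = image_mset Var a'" "?ev a = Poly_Mapping.single (a', []) 1"
          using semigroup by blast
        have "?ev (a + op_word v) = Poly_Mapping.single (a', b # s) 1"
          using word_eval_add[OF subsetD[OF free_comm_semigroup_subset_Q a] op_word_Q[OF vQ]] op a'(2)
            mmul[of a' "{#}" "b # s"] by simp
        then show ?thesis
          using 2(3) a'(1) v(1) by (intro exI[of _ "(a', b # s)"]) simp
      qed
    qed
  qed
  then show ?thesis using assms by (auto simp: Phi_words_def)
qed

lemma Phi_words_basis: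
  fixes lam :: "'k::{comm_ring, comm_monoid_mult}" and X :: "'x set"
  shows "is_module_basis scalar_ring (rb_quotient lam X) (Phi_words X) (rb_class lam X)"
proof -
  let ?R = "mixable_algebra lam :: ('k, 'x multiset \<times> 'x multiset list \<Rightarrow>\<^sub>0 'k) operated_algebra"
  let ?f = "\<lambda>x. Poly_Mapping.single ({#x#}, []) 1 :: 'x multiset \<times> 'x multiset list \<Rightarrow>\<^sub>0 'k"
  interpret rb_free lam X .
  interpret R: comm_rota_baxter_algebra scalar_ring ?R lam
    by (rule comm_rota_baxter_algebra_mixable)
  interpret E: rb_free_evaluation ?R lam X ?f
    by (intro rb_free_evaluation.intro rb_evaluation.intro word_evaluation.intro
        word_evaluation_axioms.intro)
      (auto intro: comm_operated_algebra_of_rota_baxter R.comm_rota_baxter_algebra_axioms)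
  interpret Q: scalar_module "rb_quotient lam X" by (rule rb_quotient_module)
  show ?thesis
    unfolding is_module_basis_def
  proof (intro conjI ballI allI impI)
    show "rb_class lam X \<in> Phi_words X \<rightarrow> carrier (rb_quotient lam X)"
      by (rule funcsetI) (rule funcset_mem[OF rb_class_closed subsetD[OF Phi_words_subset_Q]])
  next
    fix U assume "U \<in> carrier (rb_quotient lam X)"
    then obtain p where p: "Poly_Mapping.keys p \<subseteq> Q_words X" "U = quot.proj p"
      by (rule rb_quotient_cases)
    obtain q where q: "Poly_Mapping.keys q \<subseteq> Phi_words X" "p - q \<in> rb_ideal lam X"
      using Phi_span_Q[OF p(1)] by (auto simp: Phi_span_def)
    have qQ: "Poly_Mapping.keys q \<subseteq> Q_words X" using q(1) Phi_words_subset_Q by blast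
    have "U = quot.proj q" using quot.proj_absorb[OF q(2), of q] qQ p(2) by simp
    also have "\<dots> = lin_ext (rb_quotient lam X) (rb_class lam X) q"
      by (rule rb_class_lin_ext[OF qQ, symmetric])
    finally show "\<exists>J c. finite J \<and> J \<subseteq> Phi_words X \<and> c \<in> J \<rightarrow> carrier scalar_ring \<and>
        U = (\<Oplus>\<^bsub>rb_quotient lam X\<^esub>i\<in>J. c i \<odot>\<^bsub>rb_quotient lam X\<^esub> rb_class lam X i)"
      unfolding lin_ext_def using q(1)
      by (intro exI[of _ "Poly_Mapping.keys q"] exI[of _ "Poly_Mapping.lookup q"]) simp
  next
    fix J c
    assume *: "finite J \<and> J \<subseteq> Phi_words X \<and> c \<in> J \<rightarrow> carrier scalar_ring \<and>
      (\<Oplus>\<^bsub>rb_quotient lam X\<^esub>i\<in>J. c i \<odot>\<^bsub>rb_quotient lam X\<^esub> rb_class lam X i) = \<zero>\<^bsub>rb_quotient lam X\<^esub>"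
    then have J: "finite J" "J \<subseteq> Phi_words X" "J \<subseteq> Q_words X" using Phi_words_subset_Q by auto
    \<comment> \<open>A lift of the vanishing combination to a polynomial in words, to which
      evaluation in the separating algebra applies.\<close>
    define q where "q = (\<Sum>i\<in>J. Poly_Mapping.single i (c i))"
    have lookup_q: "Poly_Mapping.lookup q i = (if i \<in> J then c i else 0)" for i
      using J(1) by (simp add: q_def lookup_sum lookup_single when_def)
    then have keys_q: "Poly_Mapping.keys q \<subseteq> J" by (auto simp: in_keys_iff split: if_splits)
    have qQ: "Poly_Mapping.keys q \<subseteq> Q_words X" using keys_q J(3) by blast
    have "quot.proj q = (\<Oplus>\<^bsub>rb_quotient lam X\<^esub>i\<in>J. Poly_Mapping.lookup q i \<odot>\<^bsub>rb_quotient lam X\<^esub> rb_class lam X i)"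
      using rb_class_lin_ext[OF qQ] Q.lin_ext_superset[OF rb_class_closed J(1,3) keys_q] by simp
    also have "\<dots> = (\<Oplus>\<^bsub>rb_quotient lam X\<^esub>i\<in>J. c i \<odot>\<^bsub>rb_quotient lam X\<^esub> rb_class lam X i)"
      by (rule Q.M.finsum_cong')
        (use funcset_mem[OF rb_class_closed] J(3) in \<open>auto simp: lookup_q\<close>)
    finally have "quot.proj q = quot.proj 0" using * zero_rb_quotient by simp
    then have "E.poly_eval q = 0"
      using E.poly_eval_proj_cong[OF qQ, of 0] E.lin_ext_zero by simp
    moreover have "E.poly_eval q = (\<Sum>i\<in>J. pscale (Poly_Mapping.lookup q i) (word_eval ?R ?f i))"
      using E.lin_ext_superset[OF E.word_eval_Pi J(1,3) keys_q] by (simp add: finsum_mixable_algebra J(1))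
    ultimately have sum: "(\<Sum>j\<in>J. pscale (c j) (word_eval ?R ?f j)) = 0"
      by (simp add: lookup_q)
    fix i assume i: "i \<in> J"
    have "\<forall>j\<in>J. \<exists>u. j = phi_word (fst u) (snd u) \<and> word_eval ?R ?f j = Poly_Mapping.single u 1"
      using Phi_words_eval J(2) by blast
    then obtain enc where enc: "\<And>j. j \<in> J \<Longrightarrow> j = phi_word (fst (enc j)) (snd (enc j))"
      "\<And>j. j \<in> J \<Longrightarrow> word_eval ?R ?f j = Poly_Mapping.single (enc j) 1"
      by metis
    \<comment> \<open>Injectivity of \<open>enc\<close> on \<open>J\<close> comes from
      decoding.\<close>
    have enc_eq: "enc j = enc i \<longleftrightarrow> j = i" if "j \<in> J" for j
      using enc(1)[OF that] enc(1)[OF i] by metis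
    \<comment> \<open>Distinct words sit at distinct basis elements, so the coefficient at
      \<open>enc i\<close> of the vanishing sum is \<open>c i\<close> alone.\<close>
    have "0 = Poly_Mapping.lookup (\<Sum>j\<in>J. pscale (c j) (word_eval ?R ?f j)) (enc i)"
      by (simp add: sum)
    also have "\<dots> = (\<Sum>j\<in>J. if j = i then c j else 0)"
      unfolding lookup_sum by (rule sum.cong) (simp_all add: enc(2) enc_eq lookup_single when_def)
    also have "\<dots> = c i" using J(1) i by simp
    finally show "c i = \<zero>\<^bsub>scalar_ring\<^esub>" by simp
  qed
qed

theorem theorem4p3:
  fixes lam :: "'k::{comm_ring, comm_monoid_mult}" and X :: "'x set"
  shows "free_comm_rota_baxter_algebra TYPE('r) scalar_ring lam X
           (rb_quotient lam X) (\<lambda>x. rb_class lam X (var_word x))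
       \<and> is_module_basis scalar_ring (rb_quotient lam X) (Phi_words X) (rb_class lam X)"
  by (intro conjI rb_quotient_free Phi_words_basis)

end
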